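(* Let $M$ be a smooth manifold, let $G^i(x,y)$ be the local coefficients of a spray on $TM$, and let $M^i_{\ j}=\frac{\partial G^i}{\partial y^j}$. Consider the nonlinear connection on $T^2M$ with dual coefficients $$\underset{(1)}{M}{}^i_{\ j}=M^i_{\ j},\qquad \underset{(2)}{M}{}^i_{\ j}=\frac12\Big(\mathbb C(M^i_{\ j})+M^i_{\ k}M^k_{\ j}-y^kR^i_{\ jk}\Big).$$ Then: (I) A curve $c$ on $M$ is a geodesic if and only if its extension $\tilde c$ to $T^2M$ is horizontal. (II) For a vector field $w$ along a geodesic $c$ on $M$: 1. $\frac{\delta w^i}{dt}=0$ if and only if $w$ is parallel along $\dot c=y$; 2. $\frac{\delta w^{(2)i}}{dt}=0$ if and only if $w$ is a Jacobi field along $c$.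
   Context: Summation over repeated indices is used. $(x^i,y^i)$ are the natural coordinates on $TM$. Spray coefficients $G^i(x,y)$ are 2-homogeneous in $y$, $2G^i=\frac{\partial G^i}{\partial y^j}y^j$, and smooth for $y\neq0$; under changes of coordinates on $M$ they transform so that $\ddot x^i+2G^i(x,\dot x)=0$ is a globally defined system. All objects are considered at $y\neq 0$ and all curves are regular. Notation: $\mathbb C=y^k\frac{\partial}{\partial x^k}+2y^{(2)k}\frac{\partial}{\partial y^k}$; $\delta_k=\frac{\partial}{\partial x^k}-M^j_{\ k}\frac{\partial}{\partial y^j}$; $R^i_{\ jk}=\delta_kM^i_{\ j}-\delta_jM^i_{\ k}$; $L^i_{\ jk}=\frac{\partial M^i_{\ j}}{\partial y^k}$ (Berwald connection coefficients). $T^2M$ is the bundle of 2-jets of curves in $M$, with coordinates $(x^i,y^i,y^{(2)i})$, where $y^i=\dot x^i$, $y^{(2)i}=\frac12\ddot x^i$ for the jet of $t\mapsto x^i(t)$. The extension of $c:t\mapsto x^i(t)$ is $\tilde c:t\mapsto(x^i,y^i=\dot x^i,y^{(2)i}=\frac12\ddot x^i)$. Dual coefficients of a nonlinear connection on $T^2M$ are functions $\underset{(1)}{M}{}^i_{\ j},\underset{(2)}{M}{}^i_{\ j}$ such that the 1-forms $\delta y^i=dy^i+\underset{(1)}{M}{}^i_{\ j}dx^j$ and $\delta y^{(2)i}=dy^{(2)i}+\underset{(1)}{M}{}^i_{\ j}dy^j+\underset{(2)}{M}{}^i_{\ j}dx^j$ transform by $\frac{\partial\tilde x^i}{\partial x^j}$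 under changes of coordinates on $M$. The extension $\tilde c$ is horizontal if its tangent vector has vanishing $v_1$- and $v_2$-components, i.e. along $\tilde c$ $$\frac{\delta y^i}{dt}=\frac{dy^i}{dt}+\underset{(1)}{M}{}^i_{\ j}\frac{dx^j}{dt}=0,\qquad \frac{\delta y^{(2)i}}{dt}=\frac{dy^{(2)i}}{dt}+\underset{(1)}{M}{}^i_{\ j}\frac{dy^j}{dt}+\underset{(2)}{M}{}^i_{\ j}\frac{dx^j}{dt}=0.$$ A geodesic is a curve $c$ with $\frac{dy^i}{dt}+M^i_{\ j}(x,y)y^j=0$, $y=\dot x$. For a vector field $w$ along $c$, $\frac{\delta w^i}{dt}=\frac{dw^i}{dt}+M^i_{\ j}(x,y)w^j$ and $\frac{\delta w^{(2)i}}{dt}=\frac12\frac{d^2w^i}{dt^2}+\underset{(1)}{M}{}^i_{\ j}\frac{dw^j}{dt}+\underset{(2)}{M}{}^i_{\ j}w^j$, the coefficients being evaluated along $\tilde c$. The field $w$ is parallel along $\dot c=y$ if its Berwald covariant derivative $\frac{Dw^i}{dt}=\frac{dw^i}{dt}+L^i_{\ jk}(x,y)w^jy^k$ vanishes. It is a Jacobi field along the geodesic $c$ if $\frac{D^2w^i}{dt^2}=y^hy^jR_{h\ kj}^{\ i}w^k$, where $R_{j\ kl}^{\ i}=\delta_lL^i_{\ jk}-\delta_kL^i_{\ jl}+L^m_{\ jk}L^i_{\ ml}-L^m_{\ jl}L^i_{\ mk}$. *)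

theory Defs
  imports "HOL-Analysis.Analysis"
begin

section \<open>Smooth maps and smooth manifolds\<close>

primrec Ck_on :: "nat \<Rightarrow> 'a::real_normed_vector set \<Rightarrow> ('a \<Rightarrow> 'b::real_normed_vector) \<Rightarrow> bool" where
  "Ck_on 0 S f \<longleftrightarrow> continuous_on S f"
| "Ck_on (Suc k) S f \<longleftrightarrow>
     (\<forall>x\<in>S. f differentiable (at x)) \<and> (\<forall>v. Ck_on k S (\<lambda>x. frechet_derivative f (at x) v))"

text \<open>Used for open \<open>S\<close> and finite-dimensional domains only.\<close>

definition smooth_on :: "'a::real_normed_vector set \<Rightarrow> ('a \<Rightarrow> 'b::real_normed_vector) \<Rightarrow> bool" where
  "smooth_on S f \<longleftrightarrow> (\<forall>k. Ck_on k S f)"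

definition D2 :: "('a::real_normed_vector \<Rightarrow> 'b::real_normed_vector) \<Rightarrow> 'a \<Rightarrow> 'a \<Rightarrow> 'a \<Rightarrow> 'b" where
  "D2 f x u v = frechet_derivative (\<lambda>x'. frechet_derivative f (at x') u) (at x) v"

text \<open>A chart is a domain \<open>U\<close> with a coordinate map, whose values outside \<open>U\<close> are irrelevant.\<close>

type_synonym ('a, 'n) chart = "'a set \<times> ('a \<Rightarrow> real^'n)"

abbreviation cdom :: "('a, 'n::finite) chart \<Rightarrow> 'a set" where "cdom C \<equiv> fst C"
abbreviation cmap :: "('a, 'n::finite) chart \<Rightarrow> 'a \<Rightarrow> real^'n" where "cmap C \<equiv> snd C"

definition is_chart :: "'a topology \<Rightarrow> ('a, 'n::finite) chart \<Rightarrow> bool" where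
  "is_chart X C \<longleftrightarrow> openin X (cdom C) \<and> open (cmap C ` cdom C) \<and>
     homeomorphic_map (subtopology X (cdom C)) (top_of_set (cmap C ` cdom C)) (cmap C)"

definition transition :: "('a, 'n::finite) chart \<Rightarrow> ('a, 'n) chart \<Rightarrow> real^'n \<Rightarrow> real^'n" where
  "transition C D = cmap D \<circ> inv_into (cdom C) (cmap C)"

definition overlap :: "('a, 'n::finite) chart \<Rightarrow> ('a, 'n) chart \<Rightarrow> (real^'n) set" where
  "overlap C D = cmap C ` (cdom C \<inter> cdom D)"

definition smooth_manifold :: "'a topology \<Rightarrow> ('a, 'n::finite) chart set \<Rightarrow> bool" where
  "smooth_manifold X A \<longleftrightarrow> Hausdorff_space X \<and> second_countable X \<and>
     (\<forall>C\<in>A. is_chart X C) \<and> (\<Union>C\<in>A. cdom C) = topspace X \<and>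
     (\<forall>C\<in>A. \<forall>D\<in>A. smooth_on (overlap C D) (transition C D))"


section \<open>Sprays and the associated local objects\<close>

text \<open>
  Local coefficients on \<open>TM\<close> are families, indexed by charts, of functions of the induced
  coordinates \<open>(x, y)\<close>. The transformation law says that \<open>x'' + 2 G(x, x') = 0\<close> is a globally
  defined system: if \<open>h\<close> is the change of coordinates and \<open>x'' = - 2 G(x, y)\<close> with \<open>y = x'\<close>, then
  \<open>(h x)'' = D\<^sup>2h(y, y) + Dh x''\<close> has to equal \<open>- 2 G\<close> in the new coordinates.
  The coefficients are unconstrained at \<open>y = 0\<close>.
\<close>

definition spray ::
  "('a, 'n::finite) chart set \<Rightarrow> (('a, 'n) chart \<Rightarrow> real^'n \<Rightarrow> real^'n \<Rightarrow> real^'n) \<Rightarrow> bool" where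
  "spray A G \<longleftrightarrow>
     (\<forall>C\<in>A. smooth_on ((cmap C ` cdom C) \<times> (- {0})) (\<lambda>(x, y). G C x y)) \<and>
     (\<forall>C\<in>A. \<forall>x\<in>cmap C ` cdom C. \<forall>y r. y \<noteq> 0 \<longrightarrow> r > 0 \<longrightarrow> G C x (r *\<^sub>R y) = r\<^sup>2 *\<^sub>R G C x y) \<and>
     (\<forall>C\<in>A. \<forall>D\<in>A. \<forall>x\<in>overlap C D. \<forall>y. y \<noteq> 0 \<longrightarrow>
        (let h = transition C D; Dh = frechet_derivative h (at x) in
         2 *\<^sub>R G D (h x) (Dh y) = Dh (2 *\<^sub>R G C x y) - D2 h x y y))"

definition dx :: "'n::finite \<Rightarrow> (real^'n \<Rightarrow> real^'n \<Rightarrow> real) \<Rightarrow> real^'n \<Rightarrow> real^'n \<Rightarrow> real" where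
  "dx k f x y = frechet_derivative (\<lambda>x'. f x' y) (at x) (axis k 1)"

definition dy :: "'n::finite \<Rightarrow> (real^'n \<Rightarrow> real^'n \<Rightarrow> real) \<Rightarrow> real^'n \<Rightarrow> real^'n \<Rightarrow> real" where
  "dy k f x y = frechet_derivative (\<lambda>y'. f x y') (at y) (axis k 1)"

context
  fixes G :: "real^'n::finite \<Rightarrow> real^'n \<Rightarrow> real^'n"
begin

definition Mcoeff :: "'n \<Rightarrow> 'n \<Rightarrow> real^'n \<Rightarrow> real^'n \<Rightarrow> real" where
  "Mcoeff i j = dy j (\<lambda>x y. G x y $ i)"

definition hdelta :: "'n \<Rightarrow> (real^'n \<Rightarrow> real^'n \<Rightarrow> real) \<Rightarrow> real^'n \<Rightarrow> real^'n \<Rightarrow> real" where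
  "hdelta k f x y = dx k f x y - (\<Sum>j\<in>UNIV. Mcoeff j k x y * dy j f x y)"

definition Rcoeff :: "'n \<Rightarrow> 'n \<Rightarrow> 'n \<Rightarrow> real^'n \<Rightarrow> real^'n \<Rightarrow> real" where
  "Rcoeff i j k x y = hdelta k (Mcoeff i j) x y - hdelta j (Mcoeff i k) x y"

definition Lcoeff :: "'n \<Rightarrow> 'n \<Rightarrow> 'n \<Rightarrow> real^'n \<Rightarrow> real^'n \<Rightarrow> real" where
  "Lcoeff i j k = dy k (Mcoeff i j)"

text \<open>\<open>curv j i k l\<close> is \<open>R\<close> with upper index \<open>i\<close> and lower indices \<open>j, k, l\<close>.\<close>

definition curv :: "'n \<Rightarrow> 'n \<Rightarrow> 'n \<Rightarrow> 'n \<Rightarrow> real^'n \<Rightarrow> real^'n \<Rightarrow> real" where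
  "curv j i k l x y = hdelta l (Lcoeff i j k) x y - hdelta k (Lcoeff i j l) x y
     + (\<Sum>m\<in>UNIV. Lcoeff m j k x y * Lcoeff i m l x y)
     - (\<Sum>m\<in>UNIV. Lcoeff m j l x y * Lcoeff i m k x y)"

end

definition CC :: "(real^'n::finite \<Rightarrow> real^'n \<Rightarrow> real) \<Rightarrow> real^'n \<Rightarrow> real^'n \<Rightarrow> real^'n \<Rightarrow> real" where
  "CC f x y y2 = (\<Sum>k\<in>UNIV. y $ k * dx k f x y + 2 * y2 $ k * dy k f x y)"


section \<open>The second order tangent bundle and its nonlinear connections\<close>

text \<open>
  Points of \<open>T\<^sup>2M\<close> appear through their coordinates \<open>(x, y, y2)\<close> induced by a chart, the
  2-jet of \<open>t \<mapsto> x t\<close> having \<open>y = x'\<close> and \<open>y2 = x'' / 2\<close>; \<open>jet_transition h\<close> is the change of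
  these coordinates induced by the change of coordinates \<open>h\<close>.
\<close>

type_synonym 'n jet2 = "(real^'n) \<times> (real^'n) \<times> (real^'n)"

definition jet_transition :: "(real^'n \<Rightarrow> real^'n) \<Rightarrow> 'n::finite jet2 \<Rightarrow> 'n jet2" where
  "jet_transition h = (\<lambda>(x, y, y2).
     (h x, frechet_derivative h (at x) y,
      (1/2) *\<^sub>R D2 h x y y + frechet_derivative h (at x) y2))"

text \<open>The 1-forms with dual coefficients \<open>N1\<close>, \<open>N2\<close>, evaluated on a tangent vector.\<close>

definition form1 :: "('n::finite jet2 \<Rightarrow> real^'n^'n) \<Rightarrow> 'n jet2 \<Rightarrow> 'n jet2 \<Rightarrow> real^'n" where
  "form1 N1 p = (\<lambda>(vx, vy, vy2). vy + N1 p *v vx)"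

definition form2 ::
  "('n::finite jet2 \<Rightarrow> real^'n^'n) \<Rightarrow> ('n jet2 \<Rightarrow> real^'n^'n) \<Rightarrow> 'n jet2 \<Rightarrow> 'n jet2 \<Rightarrow> real^'n" where
  "form2 N1 N2 p = (\<lambda>(vx, vy, vy2). vy2 + N1 p *v vy + N2 p *v vx)"

type_synonym ('a, 'n) jet_coeffs = "('a, 'n) chart \<Rightarrow> 'n jet2 \<Rightarrow> real^'n^'n"

definition nonlinear_connection_T2 ::
  "('a, 'n::finite) chart set \<Rightarrow> ('a, 'n) jet_coeffs \<Rightarrow> ('a, 'n) jet_coeffs \<Rightarrow> bool" where
  "nonlinear_connection_T2 A N1 N2 \<longleftrightarrow>
     (\<forall>C\<in>A. \<forall>D\<in>A. \<forall>x\<in>overlap C D. \<forall>y y2 v. y \<noteq> 0 \<longrightarrow>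
        (let h = transition C D; Dh = frechet_derivative h (at x); p = (x, y, y2);
             q = jet_transition h p; w = frechet_derivative (jet_transition h) (at p) v in
         form1 (N1 D) q w = Dh (form1 (N1 C) p v) \<and>
         form2 (N1 D) (N2 D) q w = Dh (form2 (N1 C) (N2 C) p v)))"

definition dualM1 ::
  "(('a, 'n::finite) chart \<Rightarrow> real^'n \<Rightarrow> real^'n \<Rightarrow> real^'n) \<Rightarrow> ('a, 'n) jet_coeffs" where
  "dualM1 G C = (\<lambda>(x, y, y2). \<chi> i j. Mcoeff (G C) i j x y)"

definition dualM2 ::
  "(('a, 'n::finite) chart \<Rightarrow> real^'n \<Rightarrow> real^'n \<Rightarrow> real^'n) \<Rightarrow> ('a, 'n) jet_coeffs" where
  "dualM2 G C = (\<lambda>(x, y, y2). \<chi> i j. (1/2) *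
     (CC (Mcoeff (G C) i j) x y y2
      + (\<Sum>k\<in>UNIV. Mcoeff (G C) i k x y * Mcoeff (G C) k j x y)
      - (\<Sum>k\<in>UNIV. y $ k * Rcoeff (G C) i j k x y)))"


section \<open>Curves\<close>

abbreviation vel :: "(real \<Rightarrow> 'v::real_normed_vector) \<Rightarrow> real \<Rightarrow> 'v" where
  "vel x t \<equiv> vector_derivative x (at t)"

definition regular_curve ::
  "'a topology \<Rightarrow> ('a, 'n::finite) chart set \<Rightarrow> real set \<Rightarrow> (real \<Rightarrow> 'a) \<Rightarrow> bool" where
  "regular_curve X A T c \<longleftrightarrow> open T \<and> is_interval T \<and> continuous_map (top_of_set T) X c \<and>
     (\<forall>C\<in>A. smooth_on {t\<in>T. c t \<in> cdom C} (cmap C \<circ> c)) \<and>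
     (\<forall>C\<in>A. \<forall>t\<in>T. c t \<in> cdom C \<longrightarrow> vel (cmap C \<circ> c) t \<noteq> 0)"

definition extension :: "(real \<Rightarrow> real^'n::finite) \<Rightarrow> real \<Rightarrow> 'n jet2" where
  "extension x t = (x t, vel x t, (1/2) *\<^sub>R vel (vel x) t)"

definition geodesic ::
  "('a, 'n::finite) chart set \<Rightarrow> (('a, 'n) chart \<Rightarrow> real^'n \<Rightarrow> real^'n \<Rightarrow> real^'n)
   \<Rightarrow> real set \<Rightarrow> (real \<Rightarrow> 'a) \<Rightarrow> bool" where
  "geodesic A G T c \<longleftrightarrow>
     (\<forall>C\<in>A. \<forall>t\<in>T. c t \<in> cdom C \<longrightarrow>
        (let x = cmap C \<circ> c; y = vel x in
         \<forall>i. vel y t $ i + (\<Sum>j\<in>UNIV. Mcoeff (G C) i j (x t) (y t) * y t $ j) = 0))"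

definition horizontal_extension ::
  "('a, 'n::finite) chart set \<Rightarrow> ('a, 'n) jet_coeffs \<Rightarrow> ('a, 'n) jet_coeffs
   \<Rightarrow> real set \<Rightarrow> (real \<Rightarrow> 'a) \<Rightarrow> bool" where
  "horizontal_extension A N1 N2 T c \<longleftrightarrow>
     (\<forall>C\<in>A. \<forall>t\<in>T. c t \<in> cdom C \<longrightarrow>
        (let e = extension (cmap C \<circ> c) in
         form1 (N1 C) (e t) (vel e t) = 0 \<and> form2 (N1 C) (N2 C) (e t) (vel e t) = 0))"


section \<open>Vector fields along curves\<close>

text \<open>A vector field along \<open>c\<close> is given by its components in every chart.\<close>

definition vector_field_along ::
  "('a, 'n::finite) chart set \<Rightarrow> real set \<Rightarrow> (real \<Rightarrow> 'a)
   \<Rightarrow> (('a, 'n) chart \<Rightarrow> real \<Rightarrow> real^'n) \<Rightarrow> bool" where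
  "vector_field_along A T c w \<longleftrightarrow>
     (\<forall>C\<in>A. smooth_on {t\<in>T. c t \<in> cdom C} (w C)) \<and>
     (\<forall>C\<in>A. \<forall>D\<in>A. \<forall>t\<in>T. c t \<in> cdom C \<inter> cdom D \<longrightarrow>
        w D t = frechet_derivative (transition C D) (at (cmap C (c t))) (w C t))"

definition delta_w ::
  "('n::finite jet2 \<Rightarrow> real^'n^'n) \<Rightarrow> (real \<Rightarrow> real^'n) \<Rightarrow> (real \<Rightarrow> real^'n) \<Rightarrow> real \<Rightarrow> real^'n" where
  "delta_w N1 x w t = vel w t + N1 (extension x t) *v w t"

definition delta_w2 ::
  "('n::finite jet2 \<Rightarrow> real^'n^'n) \<Rightarrow> ('n jet2 \<Rightarrow> real^'n^'n)
   \<Rightarrow> (real \<Rightarrow> real^'n) \<Rightarrow> (real \<Rightarrow> real^'n) \<Rightarrow> real \<Rightarrow> real^'n" where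
  "delta_w2 N1 N2 x w t = (1/2) *\<^sub>R vel (vel w) t
     + N1 (extension x t) *v vel w t + N2 (extension x t) *v w t"

definition berwald_D ::
  "(real^'n::finite \<Rightarrow> real^'n \<Rightarrow> real^'n) \<Rightarrow> (real \<Rightarrow> real^'n) \<Rightarrow> (real \<Rightarrow> real^'n)
   \<Rightarrow> real \<Rightarrow> real^'n" where
  "berwald_D G x w t = (\<chi> i. vel w t $ i
     + (\<Sum>j\<in>UNIV. \<Sum>k\<in>UNIV. Lcoeff G i j k (x t) (vel x t) * w t $ j * vel x t $ k))"

definition parallel_along ::
  "('a, 'n::finite) chart set \<Rightarrow> (('a, 'n) chart \<Rightarrow> real^'n \<Rightarrow> real^'n \<Rightarrow> real^'n)
   \<Rightarrow> real set \<Rightarrow> (real \<Rightarrow> 'a) \<Rightarrow> (('a, 'n) chart \<Rightarrow> real \<Rightarrow> real^'n) \<Rightarrow> bool" where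
  "parallel_along A G T c w \<longleftrightarrow>
     (\<forall>C\<in>A. \<forall>t\<in>T. c t \<in> cdom C \<longrightarrow> berwald_D (G C) (cmap C \<circ> c) (w C) t = 0)"

definition jacobi_field ::
  "('a, 'n::finite) chart set \<Rightarrow> (('a, 'n) chart \<Rightarrow> real^'n \<Rightarrow> real^'n \<Rightarrow> real^'n)
   \<Rightarrow> real set \<Rightarrow> (real \<Rightarrow> 'a) \<Rightarrow> (('a, 'n) chart \<Rightarrow> real \<Rightarrow> real^'n) \<Rightarrow> bool" where
  "jacobi_field A G T c w \<longleftrightarrow>
     (\<forall>C\<in>A. \<forall>t\<in>T. c t \<in> cdom C \<longrightarrow>
        (let x = cmap C \<circ> c; y = vel x in
         \<forall>i. berwald_D (G C) x (berwald_D (G C) x (w C)) t $ i =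
           (\<Sum>h\<in>UNIV. \<Sum>j\<in>UNIV. \<Sum>k\<in>UNIV.
              y t $ h * y t $ j * curv (G C) h i k j (x t) (y t) * w C t $ k)))"

end

theory Submission
  imports Defs
begin

text \<open>
  Let \<open>h\<close> be a change of coordinates. Differentiating the transformation law of the spray in
  \<open>y\<close> gives \<open>D\<^sup>2h(y, u) + M' (Dh u) = Dh (M u)\<close>, the law of the first dual coefficient. This law
  is then differentiated in two directions of \<open>TM\<close>: along \<open>(y, 2 y2)\<close> it gives the law of
  \<open>C(M) + M M\<close>; along \<open>(v, - M v)\<close> all inhomogeneous terms are symmetric in \<open>u\<close>, \<open>v\<close>, so that
  \<open>R\<close>, the skew part, is a tensor. Together these give the law of the second dual coefficient.

  Along a curve \<open>C\<close> is differentiation in \<open>t\<close>, so the second horizontality equation is half the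
  sum of the derivative of the geodesic equation and its image under \<open>M\<close>, because \<open>R(y, y) = 0\<close>.
  Euler's identity for the 1-homogeneous \<open>M\<close> gives \<open>Dw/dt = w' + M w\<close> and \<open>y\<^sup>h R\<^sub>h\<^sup>i\<^sub>k\<^sub>j = R\<^sup>i\<^sub>k\<^sub>j\<close>, whence
  \<open>D\<^sup>2w/dt\<^sup>2 = 2 \<delta>w2/dt + R(w, y)\<close>.
\<close>

section \<open>Derivatives of smooth maps\<close>

abbreviation FD :: "('a::real_normed_vector \<Rightarrow> 'b::real_normed_vector) \<Rightarrow> 'a \<Rightarrow> 'a \<Rightarrow> 'b" where
  "FD f x \<equiv> frechet_derivative f (at x)"

lemma smooth_on_differentiable:
  assumes "smooth_on S f" "x \<in> S"
  shows "f differentiable (at x)"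
proof -
  have "Ck_on (Suc 0) S f" using assms(1) unfolding smooth_on_def by blast
  then show ?thesis using assms(2) by simp
qed

lemma smooth_on_has_derivative:
  assumes "smooth_on S f" "x \<in> S"
  shows "(f has_derivative FD f x) (at x)"
  using smooth_on_differentiable[OF assms] frechet_derivative_works by blast

lemma smooth_on_linear_FD:
  assumes "smooth_on S f" "x \<in> S"
  shows "linear (FD f x)"
  using smooth_on_differentiable[OF assms] linear_frechet_derivative by blast

lemma smooth_on_FD:
  assumes "smooth_on S f"
  shows "smooth_on S (\<lambda>x. FD f x v)"
proof -
  have "Ck_on (Suc k) S f" for k using assms unfolding smooth_on_def by blast
  then show ?thesis unfolding smooth_on_def by simp
qed

lemma smooth_on_D2:
  assumes "smooth_on S f"
  shows "smooth_on S (\<lambda>x. D2 f x u v)"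
  unfolding D2_def by (intro smooth_on_FD assms)

lemma smooth_on_continuous_on: "smooth_on S f \<Longrightarrow> continuous_on S f"
  unfolding smooth_on_def by (metis Ck_on.simps(1))

text \<open>On an open set the derivative depends only on the values of the function there, so
  agreement on \<open>S\<close> passes to all directional derivatives and the induction goes
  through.\<close>

lemma Ck_on_cong:
  assumes "open S" "\<And>x. x \<in> S \<Longrightarrow> f x = g x" "Ck_on k S f"
  shows "Ck_on k S g"
  using assms(2,3)
proof (induction k arbitrary: f g)
  case 0
  then show ?case by (metis Ck_on.simps(1) continuous_on_cong)
next
  case (Suc k)
  have d: "FD f x = FD g x \<and> g differentiable (at x)" if "x \<in> S" for x
  proof
    have "f differentiable (at x)" using Suc.prems(2) that by simp
    then show "FD f x = FD g x"
      using frechet_derivative_transform_within_open[OF _ \<open>open S\<close> that] Suc.prems(1) by blast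
    show "g differentiable (at x)"
      using \<open>f differentiable (at x)\<close> Suc.prems(1) \<open>open S\<close> that
      by (meson differentiable_def has_derivative_transform_within_open)
  qed
  have "Ck_on k S (\<lambda>x. FD g x v)" for v
    by (rule Suc.IH[where f = "\<lambda>x. FD f x v"]) (use d Suc.prems in auto)
  then show ?case using d by simp
qed

lemma smooth_on_cong:
  assumes "open S" "\<And>x. x \<in> S \<Longrightarrow> f x = g x" "smooth_on S f"
  shows "smooth_on S g"
  using assms Ck_on_cong unfolding smooth_on_def by blast

lemma FD_cong:
  assumes "f differentiable (at x)" "open S" "x \<in> S" "\<And>x. x \<in> S \<Longrightarrow> f x = g x"
  shows "FD f x = FD g x"
  by (rule frechet_derivative_transform_within_open[OF assms])

lemma D2_has_derivative:
  assumes "smooth_on S f" "x \<in> S"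
  shows "((\<lambda>x. FD f x u) has_derivative D2 f x u) (at x)"
  using smooth_on_has_derivative[OF smooth_on_FD[OF assms(1)] assms(2)]
  unfolding D2_def[abs_def] .

lemma FD_bounded_linear_comp:
  assumes "bounded_linear L" "f differentiable (at x)"
  shows "FD (\<lambda>x. L (f x)) x = (\<lambda>v. L (FD f x v))"
proof -
  have "((\<lambda>x. L (f x)) has_derivative (\<lambda>v. L (FD f x v))) (at x)"
    using assms bounded_linear.has_derivative frechet_derivative_works by blast
  then show ?thesis by (rule frechet_derivative_at[symmetric])
qed

lemma smooth_on_bounded_linear_comp:
  assumes "bounded_linear L" "open S" "smooth_on S f"
  shows "smooth_on S (\<lambda>x. L (f x))"
proof -
  have "Ck_on k S (\<lambda>x. L (f x))" if "smooth_on S f" for k f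
    using that
  proof (induction k arbitrary: f)
    case 0
    show ?case
      using bounded_linear.continuous_on[OF assms(1) smooth_on_continuous_on[OF 0]] by simp
  next
    case (Suc k)
    have "Ck_on k S (\<lambda>x. FD (\<lambda>x. L (f x)) x v)" for v
      by (rule Ck_on_cong[OF \<open>open S\<close> _ Suc.IH[OF smooth_on_FD[OF Suc.prems, of v]]])
        (simp add: FD_bounded_linear_comp[OF assms(1) smooth_on_differentiable[OF Suc.prems]])
    moreover have "(\<lambda>x. L (f x)) differentiable (at x)" if "x \<in> S" for x
      using bounded_linear.has_derivative[OF assms(1) smooth_on_has_derivative[OF Suc.prems that]]
      by (rule differentiableI)
    ultimately show ?case by simp
  qed
  then show ?thesis using assms(3) unfolding smooth_on_def[of S "\<lambda>x. L (f x)"] by blast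
qed

lemma D2_bounded_linear_comp:
  assumes L: "bounded_linear L" and S: "open S" and f: "smooth_on S f" and x: "x \<in> S"
  shows "D2 (\<lambda>x. L (f x)) x u v = L (D2 f x u v)"
proof -
  have "D2 (\<lambda>x. L (f x)) x u v = FD (\<lambda>x. L (FD f x u)) x v"
    unfolding D2_def
    by (subst FD_cong[where g = "\<lambda>x. L (FD f x u)" and S = S])
      (use S x FD_bounded_linear_comp[OF L smooth_on_differentiable[OF f]]
        smooth_on_differentiable[OF smooth_on_FD[OF smooth_on_bounded_linear_comp[OF L S f]]] in auto)
  also have "\<dots> = L (D2 f x u v)"
    unfolding D2_def
    by (subst FD_bounded_linear_comp[OF L smooth_on_differentiable[OF smooth_on_FD[OF f] x]]) simp
  finally show ?thesis .
qed

section \<open>Symmetry of second derivatives\<close>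

text \<open>The mean value theorem is used twice: on the increment of \<open>f\<close> by
  \<open>h *\<^sub>R v\<close> as a function along \<open>u\<close>, then on \<open>FD f _ u\<close>
  along \<open>v\<close>. The left hand side is symmetric in \<open>u\<close> and \<open>v\<close>,
  which is the point of the formula.\<close>

lemma second_difference:
  fixes f :: "'a::real_normed_vector \<Rightarrow> real"
  assumes f: "smooth_on S f" and S: "ball x r \<subseteq> S" and h: "0 < h" "h * (norm u + norm v) < r"
  shows "\<exists>\<sigma> \<tau>. 0 < \<sigma> \<and> \<sigma> < h \<and> 0 < \<tau> \<and> \<tau> < h \<and>
    f (x + h *\<^sub>R u + h *\<^sub>R v) - f (x + h *\<^sub>R u) - f (x + h *\<^sub>R v) + f x
      = h * (h * D2 f (x + \<sigma> *\<^sub>R u + \<tau> *\<^sub>R v) u v)"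
proof -
  have inS: "x + s *\<^sub>R u + t *\<^sub>R v \<in> S" if "0 \<le> s" "s \<le> h" "0 \<le> t" "t \<le> h" for s t
  proof -
    have "norm (s *\<^sub>R u + t *\<^sub>R v) \<le> s * norm u + t * norm v"
      using norm_triangle_ineq[of "s *\<^sub>R u" "t *\<^sub>R v"] that by simp
    also have "\<dots> \<le> h * norm u + h * norm v"
      using that by (intro add_mono mult_right_mono) auto
    finally have "dist (x + s *\<^sub>R u + t *\<^sub>R v) x < r"
      using h(2) by (simp add: dist_norm algebra_simps)
    then show ?thesis using S by (auto simp: dist_commute)
  qed
  have line: "((\<lambda>s. F (y + s *\<^sub>R w)) has_real_derivative FD F (y + s *\<^sub>R w) w) (at s)"
    if "smooth_on S F" "y + s *\<^sub>R w \<in> S" for F :: "'a \<Rightarrow> real" and y w s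
  proof -
    have "((\<lambda>s. F (y + s *\<^sub>R w)) has_derivative (\<lambda>d. FD F (y + s *\<^sub>R w) (d *\<^sub>R w))) (at s)"
      by (rule has_derivative_compose[where f = "\<lambda>s. y + s *\<^sub>R w",
            OF _ smooth_on_has_derivative[OF that]])
        (auto intro!: derivative_eq_intros)
    then show ?thesis
      using linear_scale[OF smooth_on_linear_FD[OF that], of _ w]
      by (simp add: has_field_derivative_def mult_commute_abs)
  qed
  have "\<exists>\<sigma>>0. \<sigma> < h \<and> (f ((x + h *\<^sub>R v) + h *\<^sub>R u) - f (x + h *\<^sub>R u)) - (f ((x + h *\<^sub>R v) + 0 *\<^sub>R u) - f (x + 0 *\<^sub>R u))
     = (h - 0) * (FD f ((x + h *\<^sub>R v) + \<sigma> *\<^sub>R u) u - FD f (x + \<sigma> *\<^sub>R u) u)"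
  proof (rule MVT2[OF h(1)])
    fix s assume s: "0 \<le> s" "s \<le> h"
    show "((\<lambda>s. f ((x + h *\<^sub>R v) + s *\<^sub>R u) - f (x + s *\<^sub>R u)) has_real_derivative
        FD f ((x + h *\<^sub>R v) + s *\<^sub>R u) u - FD f (x + s *\<^sub>R u) u) (at s)"
      by (intro DERIV_diff line[OF f])
        (use inS[of s h] inS[of s 0] s h in \<open>auto simp: add.assoc add.commute add.left_commute\<close>)
  qed
  then obtain \<sigma> where \<sigma>: "0 < \<sigma>" "\<sigma> < h" and 1: "f (x + h *\<^sub>R u + h *\<^sub>R v) - f (x + h *\<^sub>R u) - f (x + h *\<^sub>R v) + f x
     = h * (FD f (x + \<sigma> *\<^sub>R u + h *\<^sub>R v) u - FD f (x + \<sigma> *\<^sub>R u) u)"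
    by (auto simp: algebra_simps)
  have "\<exists>\<tau>>0. \<tau> < h \<and> FD f (x + \<sigma> *\<^sub>R u + h *\<^sub>R v) u - FD f (x + \<sigma> *\<^sub>R u + 0 *\<^sub>R v) u
     = (h - 0) * FD (\<lambda>x. FD f x u) (x + \<sigma> *\<^sub>R u + \<tau> *\<^sub>R v) v"
    by (rule MVT2[OF h(1)], rule line[OF smooth_on_FD[OF f]]) (rule inS, use \<sigma> in auto)
  then show ?thesis using \<sigma> 1 unfolding D2_def by auto
qed

text \<open>Exchanging \<open>u\<close> and \<open>v\<close> in \<open>second_difference\<close>
  yields two points near \<open>x\<close> at which the two mixed derivatives have the same value;
  continuity of both at \<open>x\<close> excludes a gap.\<close>

lemma D2_commute_real:
  fixes f :: "'a::real_normed_vector \<Rightarrow> real"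
  assumes S: "open S" and f: "smooth_on S f" and x: "x \<in> S"
  shows "D2 f x u v = D2 f x v u"
proof (rule ccontr)
  assume ne: "D2 f x u v \<noteq> D2 f x v u"
  \<comment> \<open>Half of the gap: two numbers less than \<open>e\<close> away from the two values
    at \<open>x\<close> cannot coincide.\<close>
  define e where "e = \<bar>D2 f x u v - D2 f x v u\<bar> / 2"
  have e: "e > 0" using ne by (simp add: e_def)
  have "continuous (at x) (\<lambda>x. D2 f x u v)" "continuous (at x) (\<lambda>x. D2 f x v u)"
    using S x smooth_on_continuous_on[OF smooth_on_D2[OF f]] continuous_on_eq_continuous_at by blast+
  then obtain d1 d2 where d: "d1 > 0" "d2 > 0"
    "\<And>y. dist y x < d1 \<Longrightarrow> \<bar>D2 f y u v - D2 f x u v\<bar> < e"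
    "\<And>y. dist y x < d2 \<Longrightarrow> \<bar>D2 f y v u - D2 f x v u\<bar> < e"
    using e unfolding continuous_at_eps_delta dist_real_def by blast
  obtain r0 where r0: "r0 > 0" "ball x r0 \<subseteq> S" using S x open_contains_ball by blast
  define r where "r = min r0 (min d1 d2)"
  have r: "r > 0" "ball x r \<subseteq> S" "r \<le> d1" "r \<le> d2" using r0 d by (auto simp: r_def)
  \<comment> \<open>This makes \<open>h * (norm u + norm v)\<close> at most half of
    \<open>r\<close>; the summand 1 keeps the denominator positive when \<open>u\<close> and
    \<open>v\<close> are 0.\<close>
  define h where "h = r / (2 * (norm u + norm v + 1))"
  have pos: "norm u + norm v + 1 > 0" by (simp add: add_nonneg_pos)
  have h: "h > 0" using r pos by (simp add: h_def)
  have "h * (norm u + norm v) \<le> h * (norm u + norm v + 1)" using h by simp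
  also have "\<dots> = r / 2" using pos unfolding h_def by (simp add: divide_simps del: distrib_left_numeral)
  also have "\<dots> < r" using r by simp
  finally have hr: "h * (norm u + norm v) < r" .
  have close: "dist (x + s *\<^sub>R u + t *\<^sub>R v) x < r" if "0 < s" "s < h" "0 < t" "t < h" for s t
  proof -
    have "norm (s *\<^sub>R u + t *\<^sub>R v) \<le> s * norm u + t * norm v"
      using norm_triangle_ineq[of "s *\<^sub>R u" "t *\<^sub>R v"] that by simp
    also have "\<dots> \<le> h * norm u + h * norm v"
      using that by (intro add_mono mult_right_mono) auto
    finally show ?thesis using hr by (simp add: dist_norm algebra_simps)
  qed
  obtain s t where st: "0 < s" "s < h" "0 < t" "t < h" and
    1: "f (x + h *\<^sub>R u + h *\<^sub>R v) - f (x + h *\<^sub>R u) - f (x + h *\<^sub>R v) + f x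
      = h * (h * D2 f (x + s *\<^sub>R u + t *\<^sub>R v) u v)"
    using second_difference[OF f r(2) h hr] by blast
  obtain s' t' where st': "0 < s'" "s' < h" "0 < t'" "t' < h" and
    2: "f (x + h *\<^sub>R v + h *\<^sub>R u) - f (x + h *\<^sub>R v) - f (x + h *\<^sub>R u) + f x
      = h * (h * D2 f (x + s' *\<^sub>R v + t' *\<^sub>R u) v u)"
    using second_difference[OF f r(2) h, of v u] hr by (auto simp: add.commute)
  have "x + h *\<^sub>R v + h *\<^sub>R u = x + h *\<^sub>R u + h *\<^sub>R v" by simp
  then have "h * (h * D2 f (x + s *\<^sub>R u + t *\<^sub>R v) u v) = h * (h * D2 f (x + s' *\<^sub>R v + t' *\<^sub>R u) v u)"
    using 1 2 by (simp only:)
  then have eq: "D2 f (x + s *\<^sub>R u + t *\<^sub>R v) u v = D2 f (x + s' *\<^sub>R v + t' *\<^sub>R u) v u"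
    using h by simp
  have c': "dist (x + s' *\<^sub>R v + t' *\<^sub>R u) x < r"
    using close[of t' s'] st' by (simp add: add.commute add.left_commute)
  have "\<bar>D2 f (x + s *\<^sub>R u + t *\<^sub>R v) u v - D2 f x u v\<bar> < e"
    using d(3) close[OF st] r by force
  moreover have "\<bar>D2 f (x + s' *\<^sub>R v + t' *\<^sub>R u) v u - D2 f x v u\<bar> < e"
    using d(4) c' r by force
  ultimately show False using eq unfolding e_def by argo
qed

text \<open>Inner products with basis vectors commute with \<open>D2\<close> and reduce the claim to
  real-valued maps.\<close>

lemma D2_commute:
  fixes f :: "'a::real_normed_vector \<Rightarrow> 'b::euclidean_space"
  assumes "open S" "smooth_on S f" "x \<in> S"
  shows "D2 f x u v = D2 f x v u"
proof (rule euclidean_eqI)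
  fix b :: 'b
  have L: "bounded_linear (\<lambda>z. z \<bullet> b)" by (rule bounded_linear_inner_left)
  show "D2 f x u v \<bullet> b = D2 f x v u \<bullet> b"
    using D2_commute_real[OF assms(1) smooth_on_bounded_linear_comp[OF L assms(1,2)] assms(3)]
    by (simp add: D2_bounded_linear_comp[OF L assms])
qed

section \<open>Product rules for families of linear maps\<close>

text \<open>Differentiability in \<open>q\<close> is assumed for each fixed \<open>u\<close>
  separately. Expanding the linear argument in the finite basis leaves a finite sum of coordinates
  of \<open>\<psi> p\<close> times \<open>A (\<phi> p) b\<close>, to which the ordinary product rule
  applies.\<close>

lemma linear_family_has_derivative:
  fixes A :: "'p::real_normed_vector \<Rightarrow> 'a::euclidean_space \<Rightarrow> 'b::real_normed_vector"
  assumes S: "open S" "\<phi> p \<in> S" and lin: "\<And>q. q \<in> S \<Longrightarrow> linear (A q)"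
    and A: "\<And>u. ((\<lambda>q. A q u) has_derivative A' u) (at (\<phi> p))"
    and \<phi>: "(\<phi> has_derivative \<phi>') (at p)" and \<psi>: "(\<psi> has_derivative \<psi>') (at p)"
  shows "((\<lambda>p. A (\<phi> p) (\<psi> p)) has_derivative (\<lambda>d. A' (\<psi> p) (\<phi>' d) + A (\<phi> p) (\<psi>' d))) (at p)"
proof -
  have expand: "A q u = (\<Sum>b\<in>Basis. (u \<bullet> b) *\<^sub>R A q b)" if "q \<in> S" for q u
    by (subst euclidean_representation[of u, symmetric])
      (simp only: linear_sum[OF lin[OF that]] linear_scale[OF lin[OF that]])
  have "((\<lambda>q. A q u) has_derivative (\<lambda>z. \<Sum>b\<in>Basis. (u \<bullet> b) *\<^sub>R A' b z)) (at (\<phi> p))" for u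
    by (rule has_derivative_transform_within_open[where f = "\<lambda>q. \<Sum>b\<in>Basis. (u \<bullet> b) *\<^sub>R A q b", OF _ S])
      (auto intro!: derivative_eq_intros A simp: expand[symmetric])
  then have expand': "A' u z = (\<Sum>b\<in>Basis. (u \<bullet> b) *\<^sub>R A' b z)" for u z
    using has_derivative_unique[OF A] by metis
  have cont: "continuous (at p) \<phi>" using \<phi> has_derivative_continuous by blast
  obtain T where T: "open T" "p \<in> T" "\<And>q. q \<in> T \<Longrightarrow> \<phi> q \<in> S"
    using cont[unfolded continuous_at_open, rule_format, of S] S by auto
  have "((\<lambda>p. \<Sum>b\<in>Basis. (\<psi> p \<bullet> b) *\<^sub>R A (\<phi> p) b) has_derivative
     (\<lambda>d. \<Sum>b\<in>Basis. (\<psi> p \<bullet> b) *\<^sub>R A' b (\<phi>' d) + (\<psi>' d \<bullet> b) *\<^sub>R A (\<phi> p) b)) (at p)"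
    by (intro has_derivative_sum has_derivative_scaleR has_derivative_inner_left \<psi>
        has_derivative_compose[OF \<phi> A])
  then have "((\<lambda>p. \<Sum>b\<in>Basis. (\<psi> p \<bullet> b) *\<^sub>R A (\<phi> p) b) has_derivative
      (\<lambda>d. A' (\<psi> p) (\<phi>' d) + A (\<phi> p) (\<psi>' d))) (at p)"
    by (simp only: expand[OF S(2), of "\<psi>' _"] expand'[of "\<psi> p"] sum.distrib)
  then show ?thesis
    by (rule has_derivative_transform_within_open[OF _ T(1,2)]) (simp add: expand[OF T(3), symmetric])
qed

text \<open>Additivity and homogeneity of \<open>A q\<close> pass to the derivative because
  derivatives are unique.\<close>

lemma linear_family_derivative_linear:
  assumes S: "open S" "p \<in> S" and lin: "\<And>q. q \<in> S \<Longrightarrow> linear (A q)"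
    and A: "\<And>u. ((\<lambda>q. A q u) has_derivative A' u) (at p)"
  shows "linear (\<lambda>u. A' u z)"
proof (rule linearI)
  fix u v
  have "((\<lambda>q. A q (u + v)) has_derivative (\<lambda>z. A' u z + A' v z)) (at p)"
    by (rule has_derivative_transform_within_open[OF has_derivative_add[OF A A] S])
      (simp add: linear_add[OF lin])
  then show "A' (u + v) z = A' u z + A' v z" using has_derivative_unique[OF A] by metis
next
  fix r u
  have "((\<lambda>q. A q (r *\<^sub>R u)) has_derivative (\<lambda>z. r *\<^sub>R A' u z)) (at p)"
    by (rule has_derivative_transform_within_open[OF has_derivative_scaleR_right[OF A] S])
      (simp add: linear_scale[OF lin])
  then show "A' (r *\<^sub>R u) z = r *\<^sub>R A' u z" using has_derivative_unique[OF A] by metis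
qed

lemma FD_has_derivative:
  fixes f :: "'a::euclidean_space \<Rightarrow> 'b::real_normed_vector"
  assumes "open S" "smooth_on S f" "\<phi> p \<in> S"
    and "(\<phi> has_derivative \<phi>') (at p)" "(\<psi> has_derivative \<psi>') (at p)"
  shows "((\<lambda>p. FD f (\<phi> p) (\<psi> p)) has_derivative
    (\<lambda>d. D2 f (\<phi> p) (\<psi> p) (\<phi>' d) + FD f (\<phi> p) (\<psi>' d))) (at p)"
  by (rule linear_family_has_derivative[where A = "FD f",
        OF assms(1,3) smooth_on_linear_FD[OF assms(2)] D2_has_derivative[OF assms(2,3)] assms(4,5)])

lemma D2_linear_left:
  assumes "open S" "smooth_on S f" "x \<in> S"
  shows "linear (\<lambda>u. D2 f x u v)"
  by (rule linear_family_derivative_linear[where A = "FD f",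
        OF assms(1,3) smooth_on_linear_FD[OF assms(2)] D2_has_derivative[OF assms(2,3)]])

lemma D2_linear_right:
  assumes "smooth_on S f" "x \<in> S"
  shows "linear (D2 f x u)"
  using smooth_on_linear_FD[OF smooth_on_FD[OF assms(1)] assms(2)] unfolding D2_def[abs_def] .

text \<open>The term \<open>D2 (\<lambda>q. FD f q y) x z d\<close> is the third derivative of
  \<open>f\<close> in the directions \<open>y\<close>, \<open>z\<close>, \<open>d\<close>.\<close>

lemma D2_fun_has_derivative:
  fixes f :: "'a::euclidean_space \<Rightarrow> 'b::real_normed_vector"
  assumes S: "open S" and f: "smooth_on S f" and x: "x p \<in> S"
    and x': "(x has_derivative x') (at p)" and y': "(y has_derivative y') (at p)"
    and z': "(z has_derivative z') (at p)"
  shows "((\<lambda>p. D2 f (x p) (y p) (z p)) has_derivative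
    (\<lambda>d. D2 (\<lambda>q. FD f q (y p)) (x p) (z p) (x' d) + D2 f (x p) (y' d) (z p)
       + D2 f (x p) (y p) (z' d))) (at p)"
proof -
  \<comment> \<open>\<open>D2 f x y z\<close> is read as a linear map in \<open>y\<close> over the
    base point \<open>(x, z)\<close>; for fixed \<open>y\<close> its dependence on the base point is
    covered by \<open>FD_has_derivative\<close>.\<close>
  define B where "B = (\<lambda>q u. D2 f (fst q) u (snd q))"
  define B' where "B' = (\<lambda>u d. D2 (\<lambda>q. FD f q u) (x p) (z p) (fst d) + D2 f (x p) u (snd d))"
  have "((\<lambda>p. B (x p, z p) (y p)) has_derivative
      (\<lambda>d. B' (y p) (x' d, z' d) + B (x p, z p) (y' d))) (at p)"
  proof (rule linear_family_has_derivative[where S = "S \<times> UNIV"])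
    show "open (S \<times> (UNIV :: 'a set))" "(x p, z p) \<in> S \<times> UNIV" using S x by (auto intro: open_Times)
    show "linear (B q)" if "q \<in> S \<times> UNIV" for q
      using D2_linear_left[OF S f] that unfolding B_def by auto
    show "((\<lambda>q. B q u) has_derivative B' u) (at (x p, z p))" for u
      unfolding B_def B'_def D2_def[of f, abs_def]
      by (rule FD_has_derivative[OF S smooth_on_FD[OF f], of fst "(x p, z p)" fst snd snd, simplified])
        (use x in \<open>auto intro!: derivative_eq_intros\<close>)
  qed (auto intro!: derivative_eq_intros x' y' z')
  then show ?thesis unfolding B_def B'_def by (simp add: algebra_simps)
qed

section \<open>Contractions and partial derivatives as values of linear maps\<close>

lemma linear_sum_axis:
  fixes F :: "real^'n::finite \<Rightarrow> 'b::real_vector"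
  assumes "linear F"
  shows "(\<Sum>k\<in>UNIV. v $ k *\<^sub>R F (axis k 1)) = F v"
  using linear_sum[OF assms, of "\<lambda>k. v $ k *\<^sub>R axis k 1" UNIV] linear_scale[OF assms]
    basis_expansion[of v] by (simp add: scalar_mult_eq_scaleR)

lemma linear_sum_axis_component:
  fixes F :: "real^'n::finite \<Rightarrow> real^'m"
  assumes "linear F"
  shows "(\<Sum>k\<in>UNIV. v $ k * F (axis k 1) $ i) = F v $ i"
  using arg_cong[OF linear_sum_axis[OF assms, of v], of "\<lambda>w. w $ i"] by simp

lemma has_derivative_Pair_left: "((\<lambda>x. (x, y)) has_derivative (\<lambda>d. (d, 0))) (at x within S)"
  by (intro has_derivative_Pair has_derivative_ident has_derivative_const)

lemma has_derivative_Pair_right: "((\<lambda>y. (x, y)) has_derivative (\<lambda>d. (0, d))) (at y within S)"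
  by (intro has_derivative_Pair has_derivative_ident has_derivative_const)

lemma dx_eq:
  assumes "((\<lambda>p. f (fst p) (snd p)) has_derivative F') (at (x, y))"
  shows "dx k f x y = F' (axis k 1, 0)"
proof -
  have "((\<lambda>x. f x y) has_derivative (\<lambda>d. F' (d, 0))) (at x)"
    using has_derivative_compose[OF has_derivative_Pair_left assms] by simp
  then show ?thesis unfolding dx_def by (metis frechet_derivative_at)
qed

lemma dy_eq:
  assumes "((\<lambda>p. f (fst p) (snd p)) has_derivative F') (at (x, y))"
  shows "dy k f x y = F' (0, axis k 1)"
proof -
  have "((\<lambda>y. f x y) has_derivative (\<lambda>d. F' (0, d))) (at y)"
    using has_derivative_compose[OF has_derivative_Pair_right assms] by simp
  then show ?thesis unfolding dy_def by (metis frechet_derivative_at)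
qed

text \<open>For the extension of a curve the direction \<open>(y, 2 *\<^sub>R y2)\<close> is the
  velocity \<open>(x', x'')\<close>, so \<open>CC\<close> becomes differentiation in
  \<open>t\<close>.\<close>

lemma CC_eq:
  assumes "((\<lambda>p. f (fst p) (snd p)) has_derivative F') (at (x, y))"
  shows "CC f x y y2 = F' (y, 2 *\<^sub>R y2)"
proof -
  have lin: "linear F'" using assms has_derivative_linear by blast
  have lin1: "linear (\<lambda>u. F' (u, 0))" and lin2: "linear (\<lambda>u. F' (0, u))"
    using linear_compose[OF _ lin, of "\<lambda>u. (u, 0)"] linear_compose[OF _ lin, of "\<lambda>u. (0, u)"]
    by (auto simp: o_def linear_iff)
  have "CC f x y y2 = F' (y, 0) + F' (0, 2 *\<^sub>R y2)"
    unfolding CC_def dx_eq[OF assms] dy_eq[OF assms]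
    using linear_sum_axis[OF lin1, of y] linear_sum_axis[OF lin2, of "2 *\<^sub>R y2"]
    by (simp add: sum.distrib)
  then show ?thesis by (simp flip: linear_add[OF lin])
qed

section \<open>A spray in one chart\<close>

locale local_spray =
  fixes U :: "(real^'n::finite) set" and G :: "real^'n \<Rightarrow> real^'n \<Rightarrow> real^'n"
  assumes open_U: "open U"
    and smooth: "smooth_on (U \<times> - {0}) (\<lambda>(x, y). G x y)"
    and homogeneous: "\<And>x y r. x \<in> U \<Longrightarrow> y \<noteq> 0 \<Longrightarrow> r > 0 \<Longrightarrow> G x (r *\<^sub>R y) = r\<^sup>2 *\<^sub>R G x y"
begin

text \<open>
  With \<open>p = (x, y)\<close> and the summation convention, the \<open>i\<close>-th components are
  \<open>N p u = M\<^sup>i\<^sub>j u\<^sup>j\<close>, \<open>N' p u (0, v) = L\<^sup>i\<^sub>j\<^sub>k u\<^sup>j v\<^sup>k\<close>, \<open>R p u v = R\<^sup>i\<^sub>j\<^sub>k u\<^sup>j v\<^sup>k\<close>; \<open>M2 x y y2\<close> is the second dual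
  coefficient. Working with these linear maps avoids indices in everything that follows.
\<close>

definition N :: "(real^'n) \<times> (real^'n) \<Rightarrow> real^'n \<Rightarrow> real^'n" where
  "N p u = FD (\<lambda>(x, y). G x y) p (0, u)"

definition N' :: "(real^'n) \<times> (real^'n) \<Rightarrow> real^'n \<Rightarrow> (real^'n) \<times> (real^'n) \<Rightarrow> real^'n" where
  "N' p u = FD (\<lambda>q. N q u) p"

definition R :: "(real^'n) \<times> (real^'n) \<Rightarrow> real^'n \<Rightarrow> real^'n \<Rightarrow> real^'n" where
  "R p u v = N' p u (v, - N p v) - N' p v (u, - N p u)"

definition M2 :: "real^'n \<Rightarrow> real^'n \<Rightarrow> real^'n \<Rightarrow> real^'n \<Rightarrow> real^'n" where
  "M2 x y y2 u = (1/2) *\<^sub>R (N' (x, y) u (y, 2 *\<^sub>R y2) + N (x, y) (N (x, y) u) - R (x, y) u y)"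

lemma open_W: "open (U \<times> (- {0} :: (real^'n) set))"
  using open_U by (intro open_Times) auto

lemma smooth_N: "smooth_on (U \<times> - {0}) (\<lambda>q. N q u)"
  unfolding N_def by (rule smooth_on_FD[OF smooth])

lemma linear_N: "p \<in> U \<times> - {0} \<Longrightarrow> linear (N p)"
  unfolding N_def[abs_def]
  by (rule linear_compose[of "\<lambda>u. (0, u)", unfolded o_def, OF _ smooth_on_linear_FD[OF smooth]])
    (auto simp: linear_iff)

lemma N_has_derivative: "p \<in> U \<times> - {0} \<Longrightarrow> ((\<lambda>q. N q u) has_derivative N' p u) (at p)"
  unfolding N'_def by (rule smooth_on_has_derivative[OF smooth_N])

lemma linear_N'_left: "p \<in> U \<times> - {0} \<Longrightarrow> linear (\<lambda>u. N' p u z)"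
  by (rule linear_family_derivative_linear[where A = N, OF open_W _ linear_N N_has_derivative])

lemma linear_N'_right: "p \<in> U \<times> - {0} \<Longrightarrow> linear (N' p u)"
  using N_has_derivative has_derivative_linear by blast

lemma N_fun_has_derivative:
  assumes "\<phi> p \<in> U \<times> - {0}" "(\<phi> has_derivative \<phi>') (at p)" "(\<psi> has_derivative \<psi>') (at p)"
  shows "((\<lambda>p. N (\<phi> p) (\<psi> p)) has_derivative (\<lambda>d. N' (\<phi> p) (\<psi> p) (\<phi>' d) + N (\<phi> p) (\<psi>' d))) (at p)"
  by (rule linear_family_has_derivative[where A = N, OF open_W assms(1) linear_N N_has_derivative[OF assms(1)] assms(2,3)])

text \<open>Both sides are second \<open>y\<close>-derivatives of the spray coefficients: this is
  the symmetry of the Berwald coefficients in their lower indices.\<close>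

lemma N'_vertical_commute:
  assumes "p \<in> U \<times> - {0}"
  shows "N' p u (0, v) = N' p v (0, u)"
  using D2_commute[OF open_W smooth assms, of "(0, u)" "(0, v)"]
  unfolding N'_def N_def[abs_def] D2_def .

section \<open>Homogeneity and Euler's identities\<close>

lemma G_has_derivative:
  assumes "x \<in> U" "y \<noteq> 0"
  shows "(G x has_derivative N (x, y)) (at y)"
  using has_derivative_compose[OF has_derivative_Pair_right smooth_on_has_derivative[OF smooth, of "(x, y)"]]
    assms unfolding N_def[abs_def] by simp

text \<open>Differentiating the 2-homogeneity of \<open>G\<close> in \<open>y\<close> lowers the
  degree by one: the chain rule puts a factor \<open>r\<close> on the left, which cancels against
  \<open>r\<^sup>2\<close>.\<close>

lemma N_homogeneous:
  assumes x: "x \<in> U" and y: "y \<noteq> 0" and r: "r > 0"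
  shows "N (x, r *\<^sub>R y) u = r *\<^sub>R N (x, y) u"
proof -
  have "((\<lambda>y. G x (r *\<^sub>R y)) has_derivative (\<lambda>u. N (x, r *\<^sub>R y) (r *\<^sub>R u))) (at y)"
    by (rule has_derivative_compose[where f = "\<lambda>y. r *\<^sub>R y", OF _ G_has_derivative])
      (use assms in \<open>auto intro!: derivative_eq_intros\<close>)
  moreover have "((\<lambda>y. G x (r *\<^sub>R y)) has_derivative (\<lambda>u. r\<^sup>2 *\<^sub>R N (x, y) u)) (at y)"
    by (rule has_derivative_transform_within_open[where s = "- {0}",
          OF has_derivative_scaleR_right[OF G_has_derivative[OF x y], of "r\<^sup>2"]])
      (use assms homogeneous in auto)
  ultimately have "N (x, r *\<^sub>R y) (r *\<^sub>R u) = r\<^sup>2 *\<^sub>R N (x, y) u"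
    using has_derivative_unique by metis
  moreover have "N (x, r *\<^sub>R y) (r *\<^sub>R u) = r *\<^sub>R N (x, r *\<^sub>R y) u"
    using assms by (intro linear_scale linear_N) auto
  ultimately have "r *\<^sub>R N (x, r *\<^sub>R y) u = r *\<^sub>R (r *\<^sub>R N (x, y) u)"
    by (simp add: power2_eq_square)
  then show ?thesis using r by (simp del: scaleR_scaleR)
qed

text \<open>The relation \<open>N (x, r *\<^sub>R y) u = r *\<^sub>R N (x, y) u\<close> is
  differentiated in \<open>r\<close> at 1.\<close>

lemma N'_euler:
  assumes x: "x \<in> U" and y: "y \<noteq> 0"
  shows "N' (x, y) u (0, y) = N (x, y) u"
proof -
  have p: "(x, 1 *\<^sub>R y) \<in> U \<times> - {0}" using assms by simp
  have "((\<lambda>r. N (x, r *\<^sub>R y) u) has_derivative (\<lambda>d. N' (x, 1 *\<^sub>R y) u (0, d *\<^sub>R y))) (at 1)"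
    by (rule has_derivative_compose[where f = "\<lambda>r. (x, r *\<^sub>R y)", OF _ N_has_derivative[OF p]])
      (auto intro!: derivative_eq_intros)
  moreover have "((\<lambda>r. N (x, r *\<^sub>R y) u) has_derivative (\<lambda>d. d *\<^sub>R N (x, y) u)) (at 1)"
    by (rule has_derivative_transform_within_open[where s = "{0<..}" and f = "\<lambda>r. r *\<^sub>R N (x, y) u"])
      (use N_homogeneous[OF x y] in \<open>auto intro!: derivative_eq_intros\<close>)
  ultimately have "N' (x, 1 *\<^sub>R y) u (0, 1 *\<^sub>R y) = 1 *\<^sub>R N (x, y) u"
    using has_derivative_unique by metis
  then show ?thesis by simp
qed

text \<open>Symmetry of the Berwald coefficients moves \<open>y\<close> from one lower index to the
  other in Euler's identity.\<close>

lemma N'_euler':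
  assumes "x \<in> U" "y \<noteq> 0"
  shows "N' (x, y) y (0, u) = N (x, y) u"
  using N'_euler[OF assms, of u] N'_vertical_commute[of "(x, y)" u y] assms by simp

section \<open>Coordinate expressions of the connection coefficients\<close>

lemma Mcoeff_eq:
  assumes "x \<in> U" "y \<noteq> 0"
  shows "Mcoeff G i j x y = N (x, y) (axis j 1) $ i"
proof -
  have "((\<lambda>y. G x y $ i) has_derivative (\<lambda>d. N (x, y) d $ i)) (at y)"
    by (rule bounded_linear.has_derivative[OF bounded_linear_vec_nth G_has_derivative[OF assms]])
  then show ?thesis unfolding Mcoeff_def dy_def by (metis frechet_derivative_at)
qed

lemma Mcoeff_matrix:
  assumes "x \<in> U" "y \<noteq> 0"
  shows "(\<chi> i j. Mcoeff G i j x y) *v u = N (x, y) u"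
  using fun_cong[OF matrix_vector_mul(2)[OF linear_N], of "(x, y)" u] assms
  by (simp add: Mcoeff_eq matrix_def)

text \<open>By linearity of \<open>F'\<close> the sum in \<open>hdelta\<close> collapses; what
  remains is differentiation along the horizontal lift of the \<open>k\<close>-th coordinate
  vector.\<close>

lemma hdelta_eq:
  assumes p: "x \<in> U" "y \<noteq> 0"
    and f: "((\<lambda>p. f (fst p) (snd p)) has_derivative F') (at (x, y))"
  shows "hdelta G k f x y = F' (axis k 1, - N (x, y) (axis k 1))"
proof -
  have lin: "linear F'" using f has_derivative_linear by blast
  have lin2: "linear (\<lambda>u. F' (0, u))"
    using linear_compose[OF _ lin, of "\<lambda>u. (0, u)"] by (auto simp: o_def linear_iff)
  have "hdelta G k f x y = F' (axis k 1, 0) - F' (0, N (x, y) (axis k 1))"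
    unfolding hdelta_def dx_eq[OF f] dy_eq[OF f] Mcoeff_eq[OF p]
    using linear_sum_axis[OF lin2, of "N (x, y) (axis k 1)"] by simp
  then show ?thesis by (simp flip: linear_diff[OF lin])
qed

text \<open>The formulas for coefficients hold for \<open>x\<close> in \<open>U\<close> and nonzero
  \<open>y\<close>; this set is open, so they may be used under the derivative.\<close>

lemma component_has_derivative:
  fixes F :: "(real^'n) \<times> (real^'n) \<Rightarrow> real^'m::finite"
  assumes p: "(x, y) \<in> U \<times> - {0}"
    and eq: "\<And>x y. x \<in> U \<Longrightarrow> y \<noteq> 0 \<Longrightarrow> f x y = F (x, y) $ i"
    and F: "(F has_derivative F') (at (x, y))"
  shows "((\<lambda>p. f (fst p) (snd p)) has_derivative (\<lambda>z. F' z $ i)) (at (x, y))"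
  by (rule has_derivative_transform_within_open[OF
        bounded_linear.has_derivative[OF bounded_linear_vec_nth[of i] F] open_W p])
    (simp add: eq mem_Times_iff)

lemma Mcoeff_has_derivative:
  assumes "x \<in> U" "y \<noteq> 0"
  shows "((\<lambda>p. Mcoeff G i j (fst p) (snd p)) has_derivative (\<lambda>z. N' (x, y) (axis j 1) z $ i)) (at (x, y))"
  by (rule component_has_derivative[OF _ Mcoeff_eq N_has_derivative]) (use assms in auto)

lemma linear_R_left:
  assumes "p \<in> U \<times> - {0}"
  shows "linear (\<lambda>u. R p u v)"
proof -
  have "linear (\<lambda>u. (u, - N p u))"
    using linear_N[OF assms] by (auto simp: linear_iff)
  from linear_compose[OF this linear_N'_right[OF assms, of v]] linear_N'_left[OF assms]
  show ?thesis unfolding R_def by (intro linear_compose_sub) (simp_all add: o_def)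
qed

lemma R_skew: "R p u v = - R p v u"
  unfolding R_def by simp

lemma linear_R_right:
  assumes "p \<in> U \<times> - {0}"
  shows "linear (R p u)"
  by (subst R_skew[abs_def]) (intro linear_compose_neg linear_R_left assms)

lemma Rcoeff_eq:
  assumes "x \<in> U" "y \<noteq> 0"
  shows "Rcoeff G i j k x y = R (x, y) (axis j 1) (axis k 1) $ i"
  unfolding Rcoeff_def R_def by (simp add: hdelta_eq[OF assms Mcoeff_has_derivative[OF assms]])

lemma linear_M2:
  assumes "x \<in> U" "y \<noteq> 0"
  shows "linear (M2 x y y2)"
proof -
  have p: "(x, y) \<in> U \<times> - {0}" using assms by simp
  show ?thesis unfolding M2_def[abs_def]
    by (intro linear_compose_scale_right linear_compose_sub linear_compose_add linear_N'_left
        linear_R_left p linear_compose[OF linear_N[OF p] linear_N[OF p], unfolded o_def])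
qed

text \<open>The summands match one by one: \<open>CC\<close> gives a derivative of \<open>N\<close>,
  the first sum a composite of \<open>N\<close> with itself, and the contraction of the last index
  of \<open>Rcoeff\<close> puts \<open>y\<close> into the second argument of
  \<open>R\<close>.\<close>

lemma M2_matrix:
  assumes "x \<in> U" "y \<noteq> 0"
  shows "(\<chi> i j. (1/2) * (CC (Mcoeff G i j) x y y2 + (\<Sum>k\<in>UNIV. Mcoeff G i k x y * Mcoeff G k j x y)
      - (\<Sum>k\<in>UNIV. y $ k * Rcoeff G i j k x y))) *v u = M2 x y y2 u"
proof -
  have p: "(x, y) \<in> U \<times> - {0}" using assms by simp
  have "(\<Sum>k\<in>UNIV. N (x, y) (axis k 1) $ i * N (x, y) (axis j 1) $ k) = N (x, y) (N (x, y) (axis j 1)) $ i" for i j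
    using linear_sum_axis_component[OF linear_N[OF p], of "N (x, y) (axis j 1)" i] by (simp add: mult.commute)
  then have "(\<chi> i j. (1/2) * (CC (Mcoeff G i j) x y y2 + (\<Sum>k\<in>UNIV. Mcoeff G i k x y * Mcoeff G k j x y)
      - (\<Sum>k\<in>UNIV. y $ k * Rcoeff G i j k x y))) = matrix (M2 x y y2)"
    unfolding matrix_def M2_def
    by (simp add: vec_eq_iff CC_eq[OF Mcoeff_has_derivative[OF assms]] Rcoeff_eq[OF assms]
        Mcoeff_eq[OF assms] linear_sum_axis_component[OF linear_R_right[OF p]])
  then show ?thesis by (simp only: matrix_vector_mul(2)[OF linear_M2[OF assms], THEN fun_cong])
qed

section \<open>Berwald coefficients and the contracted curvature\<close>

lemma Lcoeff_eq:
  assumes "x \<in> U" "y \<noteq> 0"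
  shows "Lcoeff G i j k x y = N' (x, y) (axis j 1) (0, axis k 1) $ i"
  unfolding Lcoeff_def dy_eq[OF Mcoeff_has_derivative[OF assms]] ..

text \<open>\<open>L' p v u z\<close> is the derivative along \<open>z\<close> of
  \<open>L\<^sup>i\<^sub>j\<^sub>k u\<^sup>j v\<^sup>k\<close> with \<open>u\<close> and
  \<open>v\<close> fixed; the vector for the first lower index comes second.\<close>

definition L' :: "(real^'n) \<times> (real^'n) \<Rightarrow> real^'n \<Rightarrow> real^'n \<Rightarrow> (real^'n) \<times> (real^'n) \<Rightarrow> real^'n" where
  "L' p v u = D2 (\<lambda>q. N q u) p (0, v)"

lemma L_has_derivative:
  assumes "p \<in> U \<times> - {0}"
  shows "((\<lambda>q. N' q u (0, v)) has_derivative L' p v u) (at p)"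
  unfolding N'_def L'_def by (rule D2_has_derivative[OF smooth_N assms])

lemma linear_L':
  assumes "p \<in> U \<times> - {0}"
  shows "linear (\<lambda>u. L' p v u z)"
  by (rule linear_family_derivative_linear[where A = "\<lambda>q u. N' q u (0, v)",
        OF open_W assms linear_N'_left L_has_derivative[OF assms]])

text \<open>This is \<open>y\<^sup>h L\<^sup>i\<^sub>h\<^sub>k = M\<^sup>i\<^sub>k\<close> differentiated in direction \<open>(a, b)\<close>.\<close>

lemma L'_euler:
  assumes "x \<in> U" "y \<noteq> 0"
  shows "L' (x, y) v y (a, b) = N' (x, y) v (a, b) - N' (x, y) b (0, v)"
proof -
  have p: "(x, y) \<in> U \<times> - {0}" using assms by simp
  have 1: "((\<lambda>q. N' q (snd q) (0, v)) has_derivative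
      (\<lambda>d. L' (x, y) v (snd (x, y)) d + N' (x, y) (snd d) (0, v))) (at (x, y))"
    by (rule linear_family_has_derivative[where A = "\<lambda>q u. N' q u (0, v)" and \<phi> = "\<lambda>q. q",
          OF open_W p linear_N'_left L_has_derivative[OF p]])
      (auto intro!: derivative_eq_intros)
  \<comment> \<open>Euler's identity replaces the same function by \<open>N q v\<close> on an open
    set, giving a second expression for its derivative.\<close>
  have 2: "((\<lambda>q. N' q (snd q) (0, v)) has_derivative N' (x, y) v) (at (x, y))"
  proof (rule has_derivative_transform_within_open[OF N_has_derivative[OF p] open_W p])
    fix q :: "(real^'n) \<times> (real^'n)"
    assume "q \<in> U \<times> - {0}"
    then show "N q v = N' q (snd q) (0, v)" by (cases q) (simp add: N'_euler')
  qed
  from fun_cong[OF has_derivative_unique[OF 1 2], of "(a, b)"]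
  show ?thesis by (simp add: algebra_simps)
qed

text \<open>After contraction, \<open>L'_euler\<close> turns each derivative of \<open>L\<close>
  into a horizontal derivative of \<open>N\<close> plus a term quadratic in the connection. These
  quadratic terms cancel against the products of \<open>L\<close> in \<open>curv\<close>, leaving
  \<open>R\<close>.\<close>

lemma curv_contract:
  assumes "x \<in> U" "y \<noteq> 0"
  shows "(\<Sum>h\<in>UNIV. y $ h * curv G h i k j x y) = R (x, y) (axis k 1) (axis j 1) $ i"
proof -
  have p: "(x, y) \<in> U \<times> - {0}" using assms by simp
  let ?p = "(x, y)" and ?e = "\<lambda>j. axis j 1 :: real^'n"
  have dL: "hdelta G l (Lcoeff G i h k) x y = L' ?p (?e k) (?e h) (?e l, - N ?p (?e l)) $ i" for h k l
    by (rule hdelta_eq[OF assms])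
      (rule component_has_derivative[OF p Lcoeff_eq L_has_derivative[OF p]])
  \<comment> \<open>The contraction with \<open>y\<close> reduces the first factor \<open>L\<close>
    to a coefficient of \<open>N\<close> by \<open>N'_euler'\<close>.\<close>
  have LL: "(\<Sum>h\<in>UNIV. y $ h * (\<Sum>m\<in>UNIV. Lcoeff G m h k x y * Lcoeff G i m l x y))
      = N' ?p (N ?p (?e k)) (0, ?e l) $ i" for k l
  proof -
    have "(\<Sum>h\<in>UNIV. y $ h * (\<Sum>m\<in>UNIV. Lcoeff G m h k x y * Lcoeff G i m l x y))
        = (\<Sum>m\<in>UNIV. (\<Sum>h\<in>UNIV. y $ h * Lcoeff G m h k x y) * Lcoeff G i m l x y)"
      unfolding sum_distrib_left sum_distrib_right
      by (subst sum.swap) (simp add: mult.assoc)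
    also have "\<dots> = (\<Sum>m\<in>UNIV. N ?p (?e k) $ m * N' ?p (?e m) (0, ?e l) $ i)"
      by (simp add: Lcoeff_eq[OF assms] linear_sum_axis_component[OF linear_N'_left[OF p]] N'_euler'[OF assms])
    also have "\<dots> = N' ?p (N ?p (?e k)) (0, ?e l) $ i"
      by (rule linear_sum_axis_component[OF linear_N'_left[OF p]])
    finally show ?thesis .
  qed
  have neg: "N' ?p (- u) z = - N' ?p u z" for u z
    using linear_neg[OF linear_N'_left[OF p]] .
  have "(\<Sum>h\<in>UNIV. y $ h * curv G h i k j x y)
      = (\<Sum>h\<in>UNIV. y $ h * L' ?p (?e k) (?e h) (?e j, - N ?p (?e j)) $ i)
      - (\<Sum>h\<in>UNIV. y $ h * L' ?p (?e j) (?e h) (?e k, - N ?p (?e k)) $ i)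
      + N' ?p (N ?p (?e k)) (0, ?e j) $ i - N' ?p (N ?p (?e j)) (0, ?e k) $ i"
    unfolding curv_def dL LL[symmetric] by (simp add: algebra_simps sum.distrib sum_subtractf)
  also have "\<dots> = R ?p (?e k) (?e j) $ i"
    by (simp add: linear_sum_axis_component[OF linear_L'[OF p]] L'_euler[OF assms] R_def neg)
  finally show ?thesis .
qed

text \<open>Summing over \<open>h\<close> first makes \<open>curv_contract\<close> applicable; the
  remaining sums are absorbed by the bilinearity of \<open>R\<close>.\<close>

lemma jacobi_rhs:
  assumes "x \<in> U" "y \<noteq> 0"
  shows "(\<Sum>h\<in>UNIV. \<Sum>j\<in>UNIV. \<Sum>k\<in>UNIV. y $ h * y $ j * curv G h i k j x y * w $ k)
    = R (x, y) w y $ i"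
proof -
  have p: "(x, y) \<in> U \<times> - {0}" using assms by simp
  have "(\<Sum>h\<in>UNIV. \<Sum>j\<in>UNIV. \<Sum>k\<in>UNIV. y $ h * y $ j * curv G h i k j x y * w $ k)
      = (\<Sum>j\<in>UNIV. \<Sum>k\<in>UNIV. \<Sum>h\<in>UNIV. y $ h * y $ j * curv G h i k j x y * w $ k)"
    by (subst sum.swap) (rule sum.cong[OF refl], rule sum.swap)
  also have "\<dots> = (\<Sum>j\<in>UNIV. y $ j * (\<Sum>k\<in>UNIV. w $ k * (\<Sum>h\<in>UNIV. y $ h * curv G h i k j x y)))"
    by (simp add: sum_distrib_left mult_ac)
  also have "\<dots> = R (x, y) w y $ i"
    by (simp add: curv_contract[OF assms] linear_sum_axis_component[OF linear_R_left[OF p]]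
        linear_sum_axis_component[OF linear_R_right[OF p]])
  finally show ?thesis .
qed

end

section \<open>Curves in one chart\<close>

lemma vel_has_vector_derivative:
  assumes "smooth_on S f" "t \<in> S"
  shows "(f has_vector_derivative vel f t) (at t)"
  using smooth_on_differentiable[OF assms] vector_derivative_works by blast

lemma smooth_on_vel:
  assumes S: "open S" and f: "smooth_on S f"
  shows "smooth_on S (vel f)"
proof (rule smooth_on_cong[OF S _ smooth_on_FD[OF f, of 1]])
  fix t assume "t \<in> S"
  from vel_has_vector_derivative[OF f this] show "FD f t 1 = vel f t"
    unfolding has_vector_derivative_def by (simp flip: frechet_derivative_at)
qed

context local_spray
begin

lemma N_along:
  assumes x: "x t \<in> U" and y: "y t \<noteq> 0"
    and x': "(x has_vector_derivative x') (at t)" and y': "(y has_vector_derivative y') (at t)"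
    and w': "(w has_vector_derivative w') (at t)"
  shows "((\<lambda>t. N (x t, y t) (w t)) has_vector_derivative
    N' (x t, y t) (w t) (x', y') + N (x t, y t) w') (at t)"
proof -
  have p: "(x t, y t) \<in> U \<times> - {0}" using x y by simp
  have "((\<lambda>t. N (x t, y t) (w t)) has_derivative
      (\<lambda>d. N' (x t, y t) (w t) (d *\<^sub>R x', d *\<^sub>R y') + N (x t, y t) (d *\<^sub>R w'))) (at t)"
    using x' y' w' unfolding has_vector_derivative_def
    by (intro N_fun_has_derivative[where \<phi> = "\<lambda>t. (x t, y t)"] has_derivative_Pair p)
  moreover have "N' (x t, y t) (w t) (d *\<^sub>R x', d *\<^sub>R y') = d *\<^sub>R N' (x t, y t) (w t) (x', y')" for d
    by (simp flip: linear_scale[OF linear_N'_right[OF p]])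
  ultimately show ?thesis
    unfolding has_vector_derivative_def
    by (simp add: scaleR_add_right linear_scale[OF linear_N[OF p]])
qed

lemma Mcoeff_sum:
  assumes "x \<in> U" "y \<noteq> 0"
  shows "(\<Sum>j\<in>UNIV. Mcoeff G i j x y * u $ j) = N (x, y) u $ i"
  using linear_sum_axis_component[OF linear_N, of "(x, y)" u i] assms
  by (simp add: Mcoeff_eq mult.commute)

text \<open>The sum over \<open>k\<close> is Euler's identity, so the Berwald derivative along a
  curve involves \<open>N\<close> alone.\<close>

lemma Lcoeff_sum:
  assumes "x \<in> U" "y \<noteq> 0"
  shows "(\<Sum>j\<in>UNIV. \<Sum>k\<in>UNIV. Lcoeff G i j k x y * u $ j * y $ k) = N (x, y) u $ i"
proof -
  have p: "(x, y) \<in> U \<times> - {0}" using assms by simp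
  have lin: "linear (\<lambda>v. N' (x, y) u (0, v))" for u
    using linear_compose[OF _ linear_N'_right[OF p], of "\<lambda>v. (0, v)" u] by (auto simp: o_def linear_iff)
  have "(\<Sum>j\<in>UNIV. \<Sum>k\<in>UNIV. Lcoeff G i j k x y * u $ j * y $ k)
      = (\<Sum>j\<in>UNIV. u $ j * (\<Sum>k\<in>UNIV. y $ k * N' (x, y) (axis j 1) (0, axis k 1) $ i))"
    by (simp add: Lcoeff_eq[OF assms] sum_distrib_left mult_ac)
  also have "\<dots> = N (x, y) u $ i"
    by (simp add: linear_sum_axis_component[OF lin] linear_sum_axis_component[OF linear_N[OF p]] N'_euler[OF assms])
  finally show ?thesis .
qed

lemma R_self: "R p u u = 0"
  unfolding R_def by simp

end

section \<open>Second order equations along a curve\<close>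

text \<open>\<open>S\<close> stands for the parameters at which a curve lies in the chart; it is
  open but may be disconnected, so the arguments are local in \<open>t\<close>.\<close>

locale local_curve = local_spray U G for U :: "(real^'n::finite) set" and G +
  fixes S :: "real set" and x :: "real \<Rightarrow> real^'n"
  assumes open_S: "open S" and smooth_x: "smooth_on S x"
    and x_in: "\<And>t. t \<in> S \<Longrightarrow> x t \<in> U" and vel_nonzero: "\<And>t. t \<in> S \<Longrightarrow> vel x t \<noteq> 0"
begin

lemmas smooth_vel = smooth_on_vel[OF open_S smooth_x]
lemmas smooth_acc = smooth_on_vel[OF open_S smooth_vel]

lemma lift_in: "t \<in> S \<Longrightarrow> (x t, vel x t) \<in> U \<times> - {0}"
  using x_in vel_nonzero by simp

lemma N_along_curve:
  assumes t: "t \<in> S" and w: "smooth_on S w"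
  shows "((\<lambda>t. N (x t, vel x t) (w t)) has_vector_derivative
    N' (x t, vel x t) (w t) (vel x t, vel (vel x) t) + N (x t, vel x t) (vel w t)) (at t)"
  by (intro N_along x_in vel_nonzero t vel_has_vector_derivative[OF _ t] smooth_x smooth_vel w)

lemma vel_extension:
  assumes t: "t \<in> S"
  shows "vel (extension x) t = (vel x t, vel (vel x) t, (1/2) *\<^sub>R vel (vel (vel x)) t)"
proof (rule vector_derivative_at)
  show "(extension x has_vector_derivative (vel x t, vel (vel x) t, (1/2) *\<^sub>R vel (vel (vel x)) t)) (at t)"
    unfolding extension_def[abs_def]
    by (intro has_vector_derivative_Pair
        bounded_linear.has_vector_derivative[OF bounded_linear_scaleR_right]
        vel_has_vector_derivative[OF _ t] smooth_x smooth_vel smooth_acc)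
qed

lemma geodesic_second_order:
  assumes geod: "\<And>t. t \<in> S \<Longrightarrow> vel (vel x) t + N (x t, vel x t) (vel x t) = 0" and t: "t \<in> S"
  shows "(1/2) *\<^sub>R vel (vel (vel x)) t + N (x t, vel x t) (vel (vel x) t)
    + M2 (x t) (vel x t) ((1/2) *\<^sub>R vel (vel x) t) (vel x t) = 0"
proof -
  let ?p = "(x t, vel x t)" and ?y = "vel x t" and ?a = "vel (vel x) t"
  note lin = linear_N[OF lift_in[OF t]]
  have "((\<lambda>t. vel (vel x) t + N (x t, vel x t) (vel x t)) has_vector_derivative
      vel (vel (vel x)) t + (N' ?p ?y (?y, ?a) + N ?p ?a)) (at t)"
    by (intro has_vector_derivative_add vel_has_vector_derivative[OF _ t] smooth_acc
        N_along_curve t smooth_vel)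
  \<comment> \<open>The geodesic equation holds on all of the open set \<open>S\<close>, so the
    derivative of its left hand side vanishes.\<close>
  moreover have "((\<lambda>t. vel (vel x) t + N (x t, vel x t) (vel x t)) has_vector_derivative 0) (at t)"
    by (rule has_vector_derivative_transform_within_open[OF has_vector_derivative_const open_S t])
      (simp add: geod)
  ultimately have 1: "vel (vel (vel x)) t + (N' ?p ?y (?y, ?a) + N ?p ?a) = 0"
    by (rule vector_derivative_unique_at)
  have 2: "N ?p ?a + N ?p (N ?p ?y) = 0"
    using geod[OF t] by (simp add: linear_0[OF lin] flip: linear_add[OF lin])
  \<comment> \<open>Twice the claim splits into the differentiated geodesic equation and the image
    of that equation under \<open>N\<close>; the curvature term has equal arguments and drops
    out.\<close>
  have "2 *\<^sub>R ((1/2) *\<^sub>R vel (vel (vel x)) t + N ?p ?a + M2 (x t) ?y ((1/2) *\<^sub>R ?a) ?y)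
      = (vel (vel (vel x)) t + (N' ?p ?y (?y, ?a) + N ?p ?a)) + (N ?p ?a + N ?p (N ?p ?y))"
    unfolding M2_def R_self by (simp add: scaleR_add_right scaleR_2)
  also have "\<dots> = 0" unfolding 1 2 by simp
  finally show ?thesis by simp
qed

lemma berwald_eq:
  assumes "t \<in> S"
  shows "berwald_D G x w t = vel w t + N (x t, vel x t) (w t)"
  unfolding berwald_D_def by (simp add: vec_eq_iff Lcoeff_sum[OF x_in[OF assms] vel_nonzero[OF assms]])

text \<open>Expanding gives \<open>w'' + 2 N w' + N (N w)\<close> plus the derivative of
  \<open>N\<close> along the curve applied to \<open>w\<close>. Twice \<open>M2\<close> supplies the
  last two terms less \<open>R(w, y)\<close>, which the final summand restores.\<close>

lemma berwald_berwald:
  assumes t: "t \<in> S" and w: "smooth_on S w"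
  shows "berwald_D G x (berwald_D G x w) t
    = 2 *\<^sub>R ((1/2) *\<^sub>R vel (vel w) t + N (x t, vel x t) (vel w t)
        + M2 (x t) (vel x t) ((1/2) *\<^sub>R vel (vel x) t) (w t))
      + R (x t, vel x t) (w t) (vel x t)"
proof -
  let ?p = "(x t, vel x t)"
  have "((\<lambda>t. vel w t + N (x t, vel x t) (w t)) has_vector_derivative
      vel (vel w) t + (N' ?p (w t) (vel x t, vel (vel x) t) + N ?p (vel w t))) (at t)"
    by (intro has_vector_derivative_add vel_has_vector_derivative[OF _ t] smooth_on_vel open_S w
        N_along_curve t)
  then have "(berwald_D G x w has_vector_derivative
      vel (vel w) t + (N' ?p (w t) (vel x t, vel (vel x) t) + N ?p (vel w t))) (at t)"
    by (rule has_vector_derivative_transform_within_open[OF _ open_S t]) (simp add: berwald_eq)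
  then show ?thesis
    unfolding berwald_eq[OF t] vector_derivative_at M2_def
    using linear_add[OF linear_N[OF lift_in[OF t]]]
    by (simp add: vector_derivative_at berwald_eq[OF t] scaleR_add_right scaleR_2 algebra_simps)
qed

end

section \<open>Changes of coordinates\<close>

text \<open>\<open>G\<close> and \<open>H\<close> are the coefficients of one spray in two charts,
  \<open>S\<close> is the overlap in source coordinates. \<open>Dh_nonzero\<close> keeps transformed
  vectors where \<open>H\<close> is smooth.\<close>

locale spray_change = src: local_spray U G + tgt: local_spray V H
  for U :: "(real^'n::finite) set" and G and V :: "(real^'n) set" and H +
  fixes S :: "(real^'n) set" and h :: "real^'n \<Rightarrow> real^'n"
  assumes open_S: "open S" and S_subset: "S \<subseteq> U" and h_in: "\<And>x. x \<in> S \<Longrightarrow> h x \<in> V"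
    and smooth_h: "smooth_on S h"
    and Dh_nonzero: "\<And>x y. x \<in> S \<Longrightarrow> y \<noteq> 0 \<Longrightarrow> FD h x y \<noteq> 0"
    and transform: "\<And>x y. x \<in> S \<Longrightarrow> y \<noteq> 0 \<Longrightarrow>
      2 *\<^sub>R H (h x) (FD h x y) = FD h x (2 *\<^sub>R G x y) - D2 h x y y"
begin

lemma linear_Dh: "x \<in> S \<Longrightarrow> linear (FD h x)"
  by (rule smooth_on_linear_FD[OF smooth_h])

lemma Dh_has_derivative:
  assumes "\<phi> p \<in> S" "(\<phi> has_derivative \<phi>') (at p)" "(\<psi> has_derivative \<psi>') (at p)"
  shows "((\<lambda>p. FD h (\<phi> p) (\<psi> p)) has_derivative
    (\<lambda>d. D2 h (\<phi> p) (\<psi> p) (\<phi>' d) + FD h (\<phi> p) (\<psi>' d))) (at p)"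
  by (rule FD_has_derivative[where f = h and \<phi> = \<phi> and \<psi> = \<psi>, OF open_S smooth_h assms])

lemma D2h_commute: "x \<in> S \<Longrightarrow> D2 h x u v = D2 h x v u"
  by (rule D2_commute[OF open_S smooth_h])

text \<open>The third derivative of \<open>h\<close> is written as a second derivative of a first
  one, so Schwarz's theorem exchanges its last two directions.\<close>

lemma D3h_commute: "x \<in> S \<Longrightarrow> D2 (\<lambda>q. FD h q y) x u v = D2 (\<lambda>q. FD h q y) x v u"
  by (rule D2_commute[OF open_S smooth_on_FD[OF smooth_h]])

lemma D2h_0: "x \<in> S \<Longrightarrow> D2 h x u 0 = 0" "x \<in> S \<Longrightarrow> D2 h x 0 u = 0"
  using linear_0[OF D2_linear_right[OF smooth_h]] linear_0[OF D2_linear_left[OF open_S smooth_h]] by auto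

lemma D3h_0: "x \<in> S \<Longrightarrow> D2 (\<lambda>q. FD h q y) x u 0 = 0"
  using linear_0[OF D2_linear_right[OF smooth_on_FD[OF smooth_h]]] .

section \<open>Transformation laws of the connection coefficients\<close>

text \<open>The spray law is differentiated in \<open>y\<close> along \<open>u\<close>. By symmetry
  the quadratic term contributes twice \<open>D2 h x y u\<close>, and a common factor 2
  cancels.\<close>

lemma N_transform:
  assumes x: "x \<in> S" and y: "y \<noteq> 0"
  shows "D2 h x y u + tgt.N (h x, FD h x y) (FD h x u) = FD h x (src.N (x, y) u)"
proof -
  have xU: "x \<in> U" and hx: "h x \<in> V" using x S_subset h_in by auto
  have 1: "((\<lambda>y. 2 *\<^sub>R H (h x) (FD h x y)) has_derivative
      (\<lambda>u. 2 *\<^sub>R tgt.N (h x, FD h x y) (FD h x u))) (at y)"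
    by (intro has_derivative_scaleR_right has_derivative_compose[OF
          linear_imp_has_derivative[OF linear_Dh[OF x]] tgt.G_has_derivative[OF hx Dh_nonzero[OF x y]]])
  have 2: "((\<lambda>y. 2 *\<^sub>R H (h x) (FD h x y)) has_derivative
      (\<lambda>u. FD h x (2 *\<^sub>R src.N (x, y) u) - (D2 h x u y + D2 h x y u))) (at y)"
  proof (rule has_derivative_transform_within_open[where s = "- {0}"])
    \<comment> \<open>The base point is constant here, so the third derivative is taken in direction
      0.\<close>
    have "((\<lambda>y. D2 h x y y) has_derivative (\<lambda>u. D2 (\<lambda>q. FD h q y) x y 0 + D2 h x u y + D2 h x y u)) (at y)"
      by (rule D2_fun_has_derivative[where x = "\<lambda>_. x" and y = "\<lambda>y. y" and z = "\<lambda>y. y", OF open_S smooth_h x])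
        auto
    then have "((\<lambda>y. D2 h x y y) has_derivative (\<lambda>u. D2 h x u y + D2 h x y u)) (at y)"
      by (simp add: D3h_0[OF x])
    then show "((\<lambda>y. FD h x (2 *\<^sub>R G x y) - D2 h x y y) has_derivative
        (\<lambda>u. FD h x (2 *\<^sub>R src.N (x, y) u) - (D2 h x u y + D2 h x y u))) (at y)"
      by (intro has_derivative_diff has_derivative_compose[OF _
            linear_imp_has_derivative[OF linear_Dh[OF x]]]
            has_derivative_scaleR_right src.G_has_derivative[OF xU y])
  qed (use y x transform in auto)
  have "2 *\<^sub>R tgt.N (h x, FD h x y) (FD h x u)
      = FD h x (2 *\<^sub>R src.N (x, y) u) - (D2 h x u y + D2 h x y u)"
    by (rule fun_cong[OF has_derivative_unique[OF 1 2]])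
  also have "\<dots> = 2 *\<^sub>R (FD h x (src.N (x, y) u) - D2 h x y u)"
    unfolding D2h_commute[OF x, of u y] linear_scale[OF linear_Dh[OF x]] scaleR_diff_right
    by (simp add: scaleR_2[of "D2 h x y u"])
  finally show ?thesis by simp
qed

text \<open>This is \<open>N_transform\<close> differentiated along \<open>(a, b)\<close> with
  \<open>u\<close> fixed. The induced change of coordinates on the tangent bundle sends
  \<open>(a, b)\<close> to \<open>(FD h x a, D2 h x y a + FD h x b)\<close>.\<close>

lemma N'_transform:
  assumes x: "x \<in> S" and y: "y \<noteq> 0"
  shows "D2 (\<lambda>q. FD h q y) x u a + D2 h x b u
      + tgt.N' (h x, FD h x y) (FD h x u) (FD h x a, D2 h x y a + FD h x b)
      + tgt.N (h x, FD h x y) (D2 h x u a)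
    = D2 h x (src.N (x, y) u) a + FD h x (src.N' (x, y) u (a, b))"
proof -
  let ?p = "(x, y)"
  have p: "?p \<in> S \<times> - {0}" and pU: "?p \<in> U \<times> - {0}"
    and q: "(h x, FD h x y) \<in> V \<times> - {0}" using x y S_subset h_in Dh_nonzero by auto
  have xp: "fst ?p \<in> S" using x by simp
  have fst': "(fst has_derivative fst) (at ?p)" and snd': "(snd has_derivative snd) (at ?p)"
    by (intro has_derivative_fst has_derivative_snd has_derivative_ident)+
  have cst: "((\<lambda>_. u) has_derivative (\<lambda>_. 0)) (at ?p)" by simp
  note hfst = has_derivative_compose[OF fst' smooth_on_has_derivative[OF smooth_h xp]]
  note dy' = Dh_has_derivative[OF xp fst' snd']
  note du' = Dh_has_derivative[OF xp fst' cst]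
  have 1: "((\<lambda>p. D2 h (fst p) (snd p) u + tgt.N (h (fst p), FD h (fst p) (snd p)) (FD h (fst p) u))
      has_derivative (\<lambda>d. (D2 (\<lambda>q. FD h q (snd ?p)) (fst ?p) u (fst d) + D2 h (fst ?p) (snd d) u
          + D2 h (fst ?p) (snd ?p) 0)
        + (tgt.N' (h (fst ?p), FD h (fst ?p) (snd ?p)) (FD h (fst ?p) u)
            (FD h (fst ?p) (fst d), D2 h (fst ?p) (snd ?p) (fst d) + FD h (fst ?p) (snd d))
          + tgt.N (h (fst ?p), FD h (fst ?p) (snd ?p)) (D2 h (fst ?p) u (fst d) + FD h (fst ?p) 0)))) (at ?p)"
    by (intro has_derivative_add D2_fun_has_derivative[where x = fst and y = snd and z = "\<lambda>_. u",
            OF open_S smooth_h xp fst' snd' cst]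
          tgt.N_fun_has_derivative[where \<phi> = "\<lambda>p. (h (fst p), FD h (fst p) (snd p))"
            and \<psi> = "\<lambda>p. FD h (fst p) u", OF _ has_derivative_Pair[OF hfst dy'] du'])
      (use q in simp)
  have 2: "((\<lambda>p. D2 h (fst p) (snd p) u + tgt.N (h (fst p), FD h (fst p) (snd p)) (FD h (fst p) u))
      has_derivative (\<lambda>d. D2 h (fst ?p) (src.N ?p u) (fst d) + FD h (fst ?p) (src.N' ?p u d))) (at ?p)"
  proof (rule has_derivative_transform_within_open[where s = "S \<times> - {0}",
          OF Dh_has_derivative[OF xp fst' src.N_has_derivative[OF pU]] _ p])
    show "open (S \<times> (- {0} :: (real^'n) set))" using open_S by (intro open_Times) auto
    fix q :: "(real^'n) \<times> (real^'n)"
    assume "q \<in> S \<times> - {0}"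
    then show "FD h (fst q) (src.N q u)
        = D2 h (fst q) (snd q) u + tgt.N (h (fst q), FD h (fst q) (snd q)) (FD h (fst q) u)"
      by (cases q) (simp add: N_transform)
  qed
  from fun_cong[OF has_derivative_unique[OF 1 2], of "(a, b)"] show ?thesis
    by (simp add: D2h_0[OF x] linear_0[OF linear_Dh[OF x]] add.assoc)
qed

text \<open>Apart from the first term, the right hand side is symmetric in \<open>u\<close> and \<open>v\<close>.\<close>

lemma delta_N_transform:
  assumes x: "x \<in> S" and y: "y \<noteq> 0"
  shows "FD h x (src.N' (x, y) u (v, - src.N (x, y) v))
    = tgt.N' (h x, FD h x y) (FD h x u) (FD h x v, - tgt.N (h x, FD h x y) (FD h x v))
      + (D2 (\<lambda>q. FD h q y) x u v - (D2 h x (src.N (x, y) v) u + D2 h x (src.N (x, y) u) v)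
      + tgt.N (h x, FD h x y) (D2 h x u v))"
proof -
  \<comment> \<open>Horizontal lifts are mapped to horizontal lifts:
    \<open>(v, - src.N (x, y) v)\<close> goes to the lift of \<open>FD h x v\<close>.\<close>
  have "D2 h x y v + FD h x (- src.N (x, y) v) = - tgt.N (h x, FD h x y) (FD h x v)"
    using N_transform[OF x y, of v] linear_neg[OF linear_Dh[OF x]] by (simp add: algebra_simps)
  moreover have "D2 h x (- src.N (x, y) v) u = - D2 h x (src.N (x, y) v) u"
    by (rule linear_neg[OF D2_linear_left[OF open_S smooth_h x]])
  ultimately show ?thesis
    using N'_transform[OF x y, of u v "- src.N (x, y) v"] by (simp add: algebra_simps)
qed

text \<open>The two instances of \<open>delta_N_transform\<close> have equal remainders once the
  symmetric terms are put in the same order, and these cancel in the difference.\<close>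

lemma R_transform:
  assumes x: "x \<in> S" and y: "y \<noteq> 0"
  shows "tgt.R (h x, FD h x y) (FD h x u) (FD h x v) = FD h x (src.R (x, y) u v)"
  unfolding src.R_def tgt.R_def linear_diff[OF linear_Dh[OF x]]
    delta_N_transform[OF x y, of u v] delta_N_transform[OF x y, of v u]
    D3h_commute[OF x, of y v u] D2h_commute[OF x, of v u]
    add.commute[of "D2 h x (src.N (x, y) u) v" "D2 h x (src.N (x, y) v) u"]
  by (simp only: add_diff_cancel_right)

text \<open>\<open>N'_transform\<close> along \<open>(y, 2 *\<^sub>R y2)\<close> handles the
  \<open>CC\<close> part, two uses of \<open>N_transform\<close> the composite of \<open>N\<close>
  with itself, and \<open>R\<close> is a tensor; the claim is half of the sum.\<close>

lemma M2_transform: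
  assumes x: "x \<in> S" and y: "y \<noteq> 0"
  shows "(1/2) *\<^sub>R D2 (\<lambda>q. FD h q y) x y u + D2 h x y2 u
      + tgt.N (h x, FD h x y) (D2 h x y u)
      + tgt.M2 (h x) (FD h x y) ((1/2) *\<^sub>R D2 h x y y + FD h x y2) (FD h x u)
    = FD h x (src.M2 x y y2 u)"
proof -
  let ?N = "tgt.N (h x, FD h x y)"
  note lin = linear_Dh[OF x]
  have q: "(h x, FD h x y) \<in> V \<times> - {0}" using x y h_in Dh_nonzero by auto
  have 1: "D2 (\<lambda>q. FD h q y) x y u + 2 *\<^sub>R D2 h x y2 u
      + tgt.N' (h x, FD h x y) (FD h x u) (FD h x y, D2 h x y y + 2 *\<^sub>R FD h x y2)
      + ?N (D2 h x y u)
    = D2 h x y (src.N (x, y) u) + FD h x (src.N' (x, y) u (y, 2 *\<^sub>R y2))"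
    using N'_transform[OF x y, of u y "2 *\<^sub>R y2"]
    by (simp add: linear_scale[OF lin] linear_scale[OF D2_linear_left[OF open_S smooth_h x]]
        D3h_commute[OF x, of y u y] D2h_commute[OF x, of u y] D2h_commute[OF x, of "src.N (x, y) u" y])
  \<comment> \<open>The right hand side obtained here and the term
    \<open>D2 h x y (src.N (x, y) u)\<close> of the preceding equation together form the left hand
    side of the next one.\<close>
  have 2: "?N (D2 h x y u) + ?N (?N (FD h x u)) = ?N (FD h x (src.N (x, y) u))"
    by (simp flip: linear_add[OF tgt.linear_N[OF q]] N_transform[OF x y])
  have 3: "D2 h x y (src.N (x, y) u) + ?N (FD h x (src.N (x, y) u)) = FD h x (src.N (x, y) (src.N (x, y) u))"
    by (rule N_transform[OF x y])
  have "2 *\<^sub>R ((1/2) *\<^sub>R D2 (\<lambda>q. FD h q y) x y u + D2 h x y2 u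
      + ?N (D2 h x y u)
      + tgt.M2 (h x) (FD h x y) ((1/2) *\<^sub>R D2 h x y y + FD h x y2) (FD h x u))
    = (D2 (\<lambda>q. FD h q y) x y u + 2 *\<^sub>R D2 h x y2 u
      + tgt.N' (h x, FD h x y) (FD h x u) (FD h x y, D2 h x y y + 2 *\<^sub>R FD h x y2)
      + ?N (D2 h x y u)) + (?N (D2 h x y u) + ?N (?N (FD h x u))) - FD h x (src.R (x, y) u y)"
    unfolding tgt.M2_def by (simp add: R_transform[OF x y] scaleR_add_right scaleR_2[of "?N _"])
  also have "\<dots> = (D2 h x y (src.N (x, y) u) + ?N (FD h x (src.N (x, y) u)))
      + FD h x (src.N' (x, y) u (y, 2 *\<^sub>R y2)) - FD h x (src.R (x, y) u y)"
    unfolding 1 2 by simp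
  also have "\<dots> = 2 *\<^sub>R FD h x (src.M2 x y y2 u)"
    unfolding 3 src.M2_def by (simp add: linear_scale[OF lin] linear_add[OF lin] linear_diff[OF lin])
  finally show ?thesis by simp
qed

section \<open>Adapted 1-forms on the second order tangent bundle\<close>

text \<open>The bracket collects the derivatives of \<open>D2 h x y y\<close> in its base point and
  in each of its two equal arguments.\<close>

lemma jet_transition_derivative:
  assumes x: "x \<in> S"
  shows "frechet_derivative (jet_transition h) (at (x, y, y2)) (vx, vy, vy2) =
    (FD h x vx, D2 h x y vx + FD h x vy,
     (1/2) *\<^sub>R (D2 (\<lambda>q. FD h q y) x y vx + D2 h x vy y + D2 h x y vy)
       + (D2 h x y2 vx + FD h x vy2))"
proof -
  let ?p = "(x, y, y2)"
  have xp: "fst ?p \<in> S" using x by simp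
  have d1: "(fst has_derivative fst) (at ?p)"
    and d2: "((\<lambda>p. fst (snd p)) has_derivative (\<lambda>p. fst (snd p))) (at ?p)"
    and d3: "((\<lambda>p. snd (snd p)) has_derivative (\<lambda>p. snd (snd p))) (at ?p)"
    by (intro has_derivative_fst has_derivative_snd has_derivative_ident)+
  note hfst = has_derivative_compose[OF d1 smooth_on_has_derivative[OF smooth_h xp]]
  have eq: "jet_transition h = (\<lambda>p. (h (fst p), FD h (fst p) (fst (snd p)),
      (1/2) *\<^sub>R D2 h (fst p) (fst (snd p)) (fst (snd p)) + FD h (fst p) (snd (snd p))))"
    unfolding jet_transition_def by (simp add: fun_eq_iff split_def)
  note has_derivative_Pair[OF hfst has_derivative_Pair[OF Dh_has_derivative[OF xp d1 d2]
        has_derivative_add[OF has_derivative_scaleR_right[OF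
            D2_fun_has_derivative[where x = fst and y = "\<lambda>p. fst (snd p)" and z = "\<lambda>p. fst (snd p)",
              OF open_S smooth_h xp d1 d2 d2], of "1/2"]
          Dh_has_derivative[OF xp d1 d3]]]]
  from fun_cong[OF frechet_derivative_at[OF this], of "(vx, vy, vy2)"]
  show ?thesis unfolding eq[symmetric] by simp
qed

lemma form1_transform:
  assumes x: "x \<in> S" and y: "y \<noteq> 0"
  shows "(D2 h x y vx + FD h x vy) + tgt.N (h x, FD h x y) (FD h x vx)
    = FD h x (vy + src.N (x, y) vx)"
  unfolding linear_add[OF linear_Dh[OF x]] N_transform[OF x y, of vx, symmetric] by (simp only: add_ac)

text \<open>Sorted by the components of the tangent vector, the \<open>vx\<close> terms are
  \<open>M2_transform\<close>, the \<open>vy\<close> terms are \<open>N_transform\<close>, and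
  \<open>vy2\<close> is mapped by \<open>FD h x\<close>.\<close>

lemma form2_transform:
  assumes x: "x \<in> S" and y: "y \<noteq> 0"
  shows "((1/2) *\<^sub>R (D2 (\<lambda>q. FD h q y) x y vx + D2 h x vy y + D2 h x y vy)
       + (D2 h x y2 vx + FD h x vy2))
      + tgt.N (h x, FD h x y) (D2 h x y vx + FD h x vy)
      + tgt.M2 (h x) (FD h x y) ((1/2) *\<^sub>R D2 h x y y + FD h x y2) (FD h x vx)
    = FD h x (vy2 + src.N (x, y) vy + src.M2 x y y2 vx)"
proof -
  have q: "(h x, FD h x y) \<in> V \<times> - {0}" using x y h_in Dh_nonzero by auto
  \<comment> \<open>The two mixed terms agree by symmetry, so the factor 1/2 leaves one of
    them.\<close>
  have "(1/2) *\<^sub>R (D2 (\<lambda>q. FD h q y) x y vx + D2 h x vy y + D2 h x y vy)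
      = (1/2) *\<^sub>R D2 (\<lambda>q. FD h q y) x y vx + D2 h x y vy"
    unfolding D2h_commute[OF x, of vy y] add.assoc scaleR_add_right[of "1/2"]
    by (simp flip: scaleR_add_left)
  then have "((1/2) *\<^sub>R (D2 (\<lambda>q. FD h q y) x y vx + D2 h x vy y + D2 h x y vy)
       + (D2 h x y2 vx + FD h x vy2))
      + tgt.N (h x, FD h x y) (D2 h x y vx + FD h x vy)
      + tgt.M2 (h x) (FD h x y) ((1/2) *\<^sub>R D2 h x y y + FD h x y2) (FD h x vx)
    = ((1/2) *\<^sub>R D2 (\<lambda>q. FD h q y) x y vx + D2 h x y2 vx
      + tgt.N (h x, FD h x y) (D2 h x y vx)
      + tgt.M2 (h x) (FD h x y) ((1/2) *\<^sub>R D2 h x y y + FD h x y2) (FD h x vx))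
      + (D2 h x y vy + tgt.N (h x, FD h x y) (FD h x vy)) + FD h x vy2"
    unfolding linear_add[OF tgt.linear_N[OF q]] by (simp only: add_ac)
  then show ?thesis
    unfolding M2_transform[OF x y, of vx y2] N_transform[OF x y, of vy] linear_add[OF linear_Dh[OF x]]
    by (simp only: add_ac)
qed

end

section \<open>The manifold\<close>

lemma chart_inj_on:
  assumes "is_chart X C"
  shows "inj_on (cmap C) (cdom C)"
proof -
  have "cdom C \<subseteq> topspace X" using assms openin_subset unfolding is_chart_def by blast
  then show ?thesis
    using assms homeomorphic_imp_injective_map unfolding is_chart_def by (metis topspace_subtopology_subset)
qed

lemma open_overlap:
  assumes C: "is_chart X C" and D: "is_chart X D"
  shows "open (overlap C D)"
proof -
  have "openin (subtopology X (cdom C)) (cdom C \<inter> cdom D)"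
    using D unfolding is_chart_def by (auto simp: openin_subtopology_Int2)
  then have "openin (top_of_set (cmap C ` cdom C)) (cmap C ` (cdom C \<inter> cdom D))"
    using C homeomorphic_imp_open_map unfolding is_chart_def open_map_def by blast
  then show ?thesis
    using C openin_open_eq unfolding is_chart_def overlap_def by blast
qed

lemma transition_apply:
  assumes "is_chart X C" "a \<in> cdom C"
  shows "transition C D (cmap C a) = cmap D a"
  using inv_into_f_f[OF chart_inj_on[OF assms(1)] assms(2)] by (simp add: transition_def)

lemma transition_in_overlap:
  assumes "is_chart X C" "x \<in> overlap C D"
  shows "transition C D x \<in> overlap D C"
proof -
  obtain a where "a \<in> cdom C" "a \<in> cdom D" "x = cmap C a"
    using assms(2) unfolding overlap_def by blast
  then show ?thesis by (simp add: transition_apply[OF assms(1)] overlap_def)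
qed

lemma transition_inverse:
  assumes "is_chart X C" "is_chart X D" "x \<in> overlap C D"
  shows "transition D C (transition C D x) = x"
proof -
  obtain a where "a \<in> cdom C" "a \<in> cdom D" "x = cmap C a"
    using assms(3) unfolding overlap_def by blast
  then show ?thesis by (simp add: transition_apply[OF assms(1)] transition_apply[OF assms(2)])
qed

text \<open>The opposite transition is an inverse, so by the chain rule the derivative has a left
  inverse and trivial kernel.\<close>

lemma transition_derivative_nonzero:
  assumes A: "smooth_manifold X A" and C: "C \<in> A" and D: "D \<in> A" and x: "x \<in> overlap C D" and y: "y \<noteq> 0"
  shows "FD (transition C D) x y \<noteq> 0"
proof
  assume 0: "FD (transition C D) x y = 0"
  have ch: "is_chart X C" "is_chart X D"
    and sm: "smooth_on (overlap C D) (transition C D)" "smooth_on (overlap D C) (transition D C)"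
    using A C D unfolding smooth_manifold_def by auto
  have 1: "((\<lambda>x. transition D C (transition C D x)) has_derivative
      (\<lambda>v. FD (transition D C) (transition C D x) (FD (transition C D) x v))) (at x)"
    by (rule has_derivative_compose[OF smooth_on_has_derivative[OF sm(1) x]
          smooth_on_has_derivative[OF sm(2) transition_in_overlap[OF ch(1) x]]])
  have 2: "((\<lambda>x. transition D C (transition C D x)) has_derivative (\<lambda>v. v)) (at x)"
    by (rule has_derivative_transform_within_open[OF has_derivative_ident open_overlap[OF ch] x])
      (simp add: transition_inverse[OF ch])
  have "FD (transition D C) (transition C D x) 0 = y"
    using fun_cong[OF has_derivative_unique[OF 1 2], of y] 0 by simp
  moreover have "FD (transition D C) (transition C D x) 0 = 0"
    by (rule linear_0[OF smooth_on_linear_FD[OF sm(2) transition_in_overlap[OF ch(1) x]]])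
  ultimately show False using y by simp
qed

lemma local_spray_chart:
  assumes A: "smooth_manifold X A" and G: "spray A G" and C: "C \<in> A"
  shows "local_spray (cmap C ` cdom C) (G C)"
proof
  show "open (cmap C ` cdom C)"
    using A C unfolding smooth_manifold_def is_chart_def by blast
  show "smooth_on (cmap C ` cdom C \<times> - {0}) (\<lambda>(x, y). G C x y)"
    using G C unfolding spray_def by blast
  show "G C x (r *\<^sub>R y) = r\<^sup>2 *\<^sub>R G C x y" if "x \<in> cmap C ` cdom C" "y \<noteq> 0" "r > 0" for x y r
    using G C that unfolding spray_def by blast
qed

lemma spray_change_charts:
  assumes A: "smooth_manifold X A" and G: "spray A G" and C: "C \<in> A" and D: "D \<in> A"
  shows "spray_change (cmap C ` cdom C) (G C) (cmap D ` cdom D) (G D) (overlap C D) (transition C D)"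
proof (intro spray_change.intro spray_change_axioms.intro)
  have ch: "is_chart X C" "is_chart X D" using A C D unfolding smooth_manifold_def by auto
  show "local_spray (cmap C ` cdom C) (G C)" "local_spray (cmap D ` cdom D) (G D)"
    by (rule local_spray_chart[OF A G], fact)+
  show "open (overlap C D)" by (rule open_overlap[OF ch])
  show "overlap C D \<subseteq> cmap C ` cdom C" unfolding overlap_def by blast
  show "transition C D x \<in> cmap D ` cdom D" if "x \<in> overlap C D" for x
    using transition_in_overlap[OF ch(1) that] unfolding overlap_def by blast
  show "smooth_on (overlap C D) (transition C D)"
    using A C D unfolding smooth_manifold_def by blast
  show "FD (transition C D) x y \<noteq> 0" if "x \<in> overlap C D" "y \<noteq> 0" for x y
    by (rule transition_derivative_nonzero[OF A C D that])
  show "2 *\<^sub>R G D (transition C D x) (FD (transition C D) x y)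
      = FD (transition C D) x (2 *\<^sub>R G C x y) - D2 (transition C D) x y y"
    if "x \<in> overlap C D" "y \<noteq> 0" for x y
    using G C D that unfolding spray_def Let_def by blast
qed

section \<open>The nonlinear connection on the manifold\<close>

lemma dualM1_mult:
  assumes "local_spray U (G C)" "x \<in> U" "y \<noteq> 0"
  shows "dualM1 G C (x, y, y2) *v u = local_spray.N (G C) (x, y) u"
  unfolding dualM1_def by (simp add: local_spray.Mcoeff_matrix[OF assms])

lemma dualM2_mult:
  assumes "local_spray U (G C)" "x \<in> U" "y \<noteq> 0"
  shows "dualM2 G C (x, y, y2) *v u = local_spray.M2 (G C) x y y2 u"
  unfolding dualM2_def prod.case by (rule local_spray.M2_matrix[OF assms])

lemma nonlinear_connection_dualM:
  fixes A :: "('a, 'n::finite) chart set"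
  assumes A: "smooth_manifold X A" and G: "spray A G"
  shows "nonlinear_connection_T2 A (dualM1 G) (dualM2 G)"
  unfolding nonlinear_connection_T2_def Let_def
proof (intro ballI allI impI)
  fix C D x and y y2 :: "real^'n" and v :: "'n jet2"
  assume C: "C \<in> A" and D: "D \<in> A" and x: "x \<in> overlap C D" and y: "y \<noteq> 0"
  obtain vx vy vy2 where v: "v = (vx, vy, vy2)" by (cases v)
  let ?h = "transition C D"
  interpret spray_change "cmap C ` cdom C" "G C" "cmap D ` cdom D" "G D" "overlap C D" ?h
    by (rule spray_change_charts[OF A G C D])
  have xC: "x \<in> cmap C ` cdom C" using x S_subset by blast
  note m = dualM1_mult[where G = G and C = C, OF src.local_spray_axioms xC y]
    dualM1_mult[where G = G and C = D, OF tgt.local_spray_axioms h_in[OF x] Dh_nonzero[OF x y]]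
    dualM2_mult[where G = G and C = C, OF src.local_spray_axioms xC y]
    dualM2_mult[where G = G and C = D, OF tgt.local_spray_axioms h_in[OF x] Dh_nonzero[OF x y]]
  have q: "jet_transition ?h (x, y, y2) = (?h x, FD ?h x y, (1/2) *\<^sub>R D2 ?h x y y + FD ?h x y2)"
    by (simp add: jet_transition_def)
  show "form1 (dualM1 G D) (jet_transition ?h (x, y, y2)) (FD (jet_transition ?h) (x, y, y2) v)
        = FD ?h x (form1 (dualM1 G C) (x, y, y2) v) \<and>
      form2 (dualM1 G D) (dualM2 G D) (jet_transition ?h (x, y, y2)) (FD (jet_transition ?h) (x, y, y2) v)
        = FD ?h x (form2 (dualM1 G C) (dualM2 G C) (x, y, y2) v)"
    unfolding v form1_def form2_def jet_transition_derivative[OF x] q prod.case m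
    by (intro conjI form1_transform[OF x y] form2_transform[OF x y])
qed

section \<open>Horizontal extensions, parallel fields and Jacobi fields\<close>

lemma local_curve_chart:
  assumes A: "smooth_manifold X A" and G: "spray A G" and c: "regular_curve X A T c" and C: "C \<in> A"
  shows "local_curve (cmap C ` cdom C) (G C) {t \<in> T. c t \<in> cdom C} (cmap C \<circ> c)"
proof (intro local_curve.intro local_curve_axioms.intro local_spray_chart[OF A G C])
  have T: "open T" and cont: "continuous_map (top_of_set T) X c"
    using c unfolding regular_curve_def by auto
  have "openin X (cdom C)" using A C unfolding smooth_manifold_def is_chart_def by blast
  then have "openin (top_of_set T) {t \<in> T. c t \<in> cdom C}"
    using openin_continuous_map_preimage[OF cont] by simp
  then show "open {t \<in> T. c t \<in> cdom C}" using T openin_open_eq by blast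
qed (use c C in \<open>auto simp: regular_curve_def\<close>)

lemma geodesic_iff:
  assumes A: "smooth_manifold X A" and G: "spray A G" and c: "regular_curve X A T c"
  shows "geodesic A G T c \<longleftrightarrow> (\<forall>C\<in>A. \<forall>t\<in>T. c t \<in> cdom C \<longrightarrow>
    (let x = cmap C \<circ> c in vel (vel x) t + local_spray.N (G C) (x t, vel x t) (vel x t) = 0))"
  unfolding geodesic_def Let_def
proof (intro ball_cong refl imp_cong)
  fix C t assume C: "C \<in> A" and t: "t \<in> T" "c t \<in> cdom C"
  let ?x = "cmap C \<circ> c"
  interpret local_curve "cmap C ` cdom C" "G C" "{t \<in> T. c t \<in> cdom C}" ?x
    by (rule local_curve_chart[OF A G c C])
  have tS: "t \<in> {t \<in> T. c t \<in> cdom C}" using t by simp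
  show "(\<forall>i. vel (vel ?x) t $ i + (\<Sum>j\<in>UNIV. Mcoeff (G C) i j (?x t) (vel ?x t) * vel ?x t $ j) = 0)
      = (vel (vel ?x) t + N (?x t, vel ?x t) (vel ?x t) = 0)"
    unfolding Mcoeff_sum[OF x_in[OF tS] vel_nonzero[OF tS]] by (simp add: vec_eq_iff)
qed

lemma geodesic_iff_horizontal:
  assumes A: "smooth_manifold X A" and G: "spray A G" and c: "regular_curve X A T c"
  shows "geodesic A G T c \<longleftrightarrow> horizontal_extension A (dualM1 G) (dualM2 G) T c"
proof -
  \<comment> \<open>The first form evaluates to the geodesic equation, the second to the expression
    in \<open>geodesic_second_order\<close>.\<close>
  have "(form1 (dualM1 G C) (extension x t) (vel (extension x) t) = 0
        \<longleftrightarrow> vel (vel x) t + local_spray.N (G C) (x t, vel x t) (vel x t) = 0)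
      \<and> (form2 (dualM1 G C) (dualM2 G C) (extension x t) (vel (extension x) t) =
        (1/2) *\<^sub>R vel (vel (vel x)) t + local_spray.N (G C) (x t, vel x t) (vel (vel x) t)
        + local_spray.M2 (G C) (x t) (vel x t) ((1/2) *\<^sub>R vel (vel x) t) (vel x t))"
    if C: "C \<in> A" and t: "t \<in> T" "c t \<in> cdom C" and x: "x = cmap C \<circ> c" for C t x
  proof -
    interpret local_curve "cmap C ` cdom C" "G C" "{t \<in> T. c t \<in> cdom C}" x
      unfolding x by (rule local_curve_chart[OF A G c C])
    have tS: "t \<in> {t \<in> T. c t \<in> cdom C}" using t by simp
    show ?thesis
      unfolding vel_extension[OF tS] extension_def form1_def form2_def prod.case
        dualM1_mult[where G = G and C = C, OF local_spray_axioms x_in[OF tS] vel_nonzero[OF tS]]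
        dualM2_mult[where G = G and C = C, OF local_spray_axioms x_in[OF tS] vel_nonzero[OF tS]]
      by simp
  qed
  note forms = this[OF _ _ _ refl]
  show ?thesis
  proof
    assume geod: "geodesic A G T c"
    show "horizontal_extension A (dualM1 G) (dualM2 G) T c"
      unfolding horizontal_extension_def Let_def
    proof (intro ballI impI)
      fix C t assume C: "C \<in> A" and t: "t \<in> T" "c t \<in> cdom C"
      interpret local_curve "cmap C ` cdom C" "G C" "{t \<in> T. c t \<in> cdom C}" "cmap C \<circ> c"
        by (rule local_curve_chart[OF A G c C])
      \<comment> \<open>The equation is recorded at every parameter in the chart because it is going
        to be differentiated.\<close>
      have g: "vel (vel (cmap C \<circ> c)) t
          + N ((cmap C \<circ> c) t, vel (cmap C \<circ> c) t) (vel (cmap C \<circ> c) t) = 0"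
        if "t \<in> {t \<in> T. c t \<in> cdom C}" for t
        using geod C that unfolding geodesic_iff[OF A G c] Let_def by blast
      have tS: "t \<in> {t \<in> T. c t \<in> cdom C}" using t by simp
      show "form1 (dualM1 G C) (extension (cmap C \<circ> c) t) (vel (extension (cmap C \<circ> c)) t) = 0 \<and>
        form2 (dualM1 G C) (dualM2 G C) (extension (cmap C \<circ> c) t) (vel (extension (cmap C \<circ> c)) t) = 0"
        using forms[OF C t] g[OF tS] geodesic_second_order[OF g tS] by metis
    qed
  next
    assume "horizontal_extension A (dualM1 G) (dualM2 G) T c"
    \<comment> \<open>The vanishing of the first form is already the geodesic equation.\<close>
    then show "geodesic A G T c"
      unfolding horizontal_extension_def geodesic_iff[OF A G c] Let_def using forms by blast
  qed
qed

text \<open>By \<open>berwald_eq\<close>, which rests on Euler's identity, both conditions say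
  \<open>w' + N w = 0\<close> in each chart.\<close>

lemma delta_w_iff_parallel:
  assumes A: "smooth_manifold X A" and G: "spray A G" and c: "regular_curve X A T c"
  shows "(\<forall>C\<in>A. \<forall>t\<in>T. c t \<in> cdom C \<longrightarrow> delta_w (dualM1 G C) (cmap C \<circ> c) (w C) t = 0)
    \<longleftrightarrow> parallel_along A G T c w"
  unfolding parallel_along_def
proof (intro ball_cong refl imp_cong)
  fix C t assume C: "C \<in> A" and t: "t \<in> T" "c t \<in> cdom C"
  interpret local_curve "cmap C ` cdom C" "G C" "{t \<in> T. c t \<in> cdom C}" "cmap C \<circ> c"
    by (rule local_curve_chart[OF A G c C])
  have tS: "t \<in> {t \<in> T. c t \<in> cdom C}" using t by simp
  show "(delta_w (dualM1 G C) (cmap C \<circ> c) (w C) t = 0) = (berwald_D (G C) (cmap C \<circ> c) (w C) t = 0)"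
    unfolding delta_w_def berwald_eq[OF tS] extension_def
      dualM1_mult[where G = G and C = C, OF local_spray_axioms x_in[OF tS] vel_nonzero[OF tS]] ..
qed

text \<open>By \<open>berwald_berwald\<close> the second Berwald derivative exceeds
  \<open>R(w, y)\<close> by twice \<open>delta_w2\<close>, and \<open>jacobi_rhs\<close> identifies
  \<open>R(w, y)\<close> with the curvature side of the Jacobi equation.\<close>

lemma delta_w2_iff_jacobi:
  assumes A: "smooth_manifold X A" and G: "spray A G" and c: "regular_curve X A T c"
    and w: "vector_field_along A T c w"
  shows "(\<forall>C\<in>A. \<forall>t\<in>T. c t \<in> cdom C \<longrightarrow>
      delta_w2 (dualM1 G C) (dualM2 G C) (cmap C \<circ> c) (w C) t = 0)
    \<longleftrightarrow> jacobi_field A G T c w"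
  unfolding jacobi_field_def Let_def
proof (intro ball_cong refl imp_cong)
  fix C t assume C: "C \<in> A" and t: "t \<in> T" "c t \<in> cdom C"
  let ?x = "cmap C \<circ> c"
  interpret local_curve "cmap C ` cdom C" "G C" "{t \<in> T. c t \<in> cdom C}" ?x
    by (rule local_curve_chart[OF A G c C])
  have tS: "t \<in> {t \<in> T. c t \<in> cdom C}" using t by simp
  have sw: "smooth_on {t \<in> T. c t \<in> cdom C} (w C)" using w C unfolding vector_field_along_def by blast
  have "berwald_D (G C) ?x (berwald_D (G C) ?x (w C)) t =
      2 *\<^sub>R delta_w2 (dualM1 G C) (dualM2 G C) ?x (w C) t + R (?x t, vel ?x t) (w C t) (vel ?x t)"
    unfolding berwald_berwald[OF tS sw] delta_w2_def extension_def
      dualM1_mult[where G = G and C = C, OF local_spray_axioms x_in[OF tS] vel_nonzero[OF tS]]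
      dualM2_mult[where G = G and C = C, OF local_spray_axioms x_in[OF tS] vel_nonzero[OF tS]] ..
  then show "(delta_w2 (dualM1 G C) (dualM2 G C) ?x (w C) t = 0) =
    (\<forall>i. berwald_D (G C) ?x (berwald_D (G C) ?x (w C)) t $ i =
      (\<Sum>h\<in>UNIV. \<Sum>j\<in>UNIV. \<Sum>k\<in>UNIV.
        vel ?x t $ h * vel ?x t $ j * curv (G C) h i k j (?x t) (vel ?x t) * w C t $ k))"
    unfolding jacobi_rhs[OF x_in[OF tS] vel_nonzero[OF tS]] by (simp add: vec_eq_iff)
qed

theorem mainTheorem4:
  fixes X :: "'a topology"
    and A :: "('a, 'n::finite) chart set"
    and G :: "('a, 'n) chart \<Rightarrow> real^'n \<Rightarrow> real^'n \<Rightarrow> real^'n"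
  assumes "smooth_manifold X A"
    and "spray A G"
  shows "nonlinear_connection_T2 A (dualM1 G) (dualM2 G) \<and>
    (\<forall>T c. regular_curve X A T c \<longrightarrow>
       (geodesic A G T c \<longleftrightarrow> horizontal_extension A (dualM1 G) (dualM2 G) T c)) \<and>
    (\<forall>T c w. regular_curve X A T c \<longrightarrow> geodesic A G T c \<longrightarrow> vector_field_along A T c w \<longrightarrow>
       ((\<forall>C\<in>A. \<forall>t\<in>T. c t \<in> cdom C \<longrightarrow>
            delta_w (dualM1 G C) (cmap C \<circ> c) (w C) t = 0)
          \<longleftrightarrow> parallel_along A G T c w) \<and>
       ((\<forall>C\<in>A. \<forall>t\<in>T. c t \<in> cdom C \<longrightarrow>
            delta_w2 (dualM1 G C) (dualM2 G C) (cmap C \<circ> c) (w C) t = 0)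
          \<longleftrightarrow> jacobi_field A G T c w))"
  using nonlinear_connection_dualM[OF assms] geodesic_iff_horizontal[OF assms]
    delta_w_iff_parallel[OF assms] delta_w2_iff_jacobi[OF assms] by blast

end
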